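(* Let $X=L^2[0,1]$, let $V:X\to X$ be the Volterra integration operator $(Vx)(t)=\int_0^tx$, let $T=V^{-1}$, and set $$H:=\{x\in L^2[0,1]: x\text{ is absolutely continuous, and }x'\in L^2[0,1]\}.$$ Then for all $(x,x^* )\in X\times X$, $$F_{T+T^*}(x,x^* )=\iota_{X\times\{0\}}(x,x^* ),$$ $$(F_T\Box_2F_{T^*})(x,x^* )=\begin{cases}\tfrac12\left[x(1)^2+x(0)^2\right], & \text{if }(x,x^* )\in H\times\{0\};\\ \infty, & \text{otherwise.}\end{cases}$$ Consequently, $F_T\Box_2F_{T^*}\ne F_{T+T^*}$.
   Context: $L^2[0,1]$ is the real Hilbert space of (classes of) square-integrable real functions on $[0,1]$ with inner product $\langle x,y\rangle=\int_0^1xy$. An element is called absolutely continuous if it has an absolutely continuous representative on $[0,1]$; point values $x(0),x(1)$ refer to that representative, and $x'$ is its (a.e.) derivative. $V$ is injective. For a set-valued operator $A:X\rightrightarrows X$, $\operatorname{gra}A=\{(x,x^* )\in X\times X\mid x^*\in Ax\}$, $\operatorname{dom}A=\{x\mid Ax\ne\varnothing\}$, and $A^{-1}$ is the operator with graph $\{(x^*,x)\mid(x,x^* )\in\operatorname{gra}A\}$. At most single-valued linear relations (operators whose graph is a linear subspace) are identified with linear operators on their domains. The adjoint of a linear relation $A$ is defined by $\operatorname{gra}A^*=\{(x,x^* )\mid(x^*,-x)\in(\operatorname{gra}A)^\perp\}$. The sum is $(A+B)x=Ax+Bx$ with domain $\operatorname{dom}A\cap\operatorname{dom}B$. The Fitzpatrick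 function of $A$ is $F_A:X\times X\to\,]-\infty,+\infty]$, $F_A(x,x^* )=\sup_{(a,a^* )\in\operatorname{gra}A}\big(\langle x,a^*\rangle+\langle a,x^*\rangle-\langle a,a^*\rangle\big)$. For $F_1,F_2:X\times X\to\,]-\infty,+\infty]$, the partial inf-convolution is $(F_1\Box_2F_2)(x,x^* )=\inf_{y^*\in X}\big(F_1(x,x^*-y^* )+F_2(x,y^* )\big)$. For a set $C$, $\iota_C$ is its indicator function ($0$ on $C$, $+\infty$ off $C$). *)

theory Defs
  imports "HOL-Analysis.Analysis"
begin

section \<open>The Hilbert space of square-integrable functions on the unit interval\<close>

abbreviation L01 :: "real measure" where
  "L01 \<equiv> lebesgue_on {0..1}"

definition sq_integrable :: "(real \<Rightarrow> real) \<Rightarrow> bool" where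
  "sq_integrable f \<longleftrightarrow> f \<in> borel_measurable L01 \<and> integrable L01 (\<lambda>t. (f t)\<^sup>2)"

lemma sq_integrable_mult:
  assumes "sq_integrable f" "sq_integrable g"
  shows "integrable L01 (\<lambda>t. f t * g t)"
proof (rule Bochner_Integration.integrable_bound)
  show "integrable L01 (\<lambda>t. (f t)\<^sup>2 + (g t)\<^sup>2)"
    using assms by (auto simp: sq_integrable_def)
  show "(\<lambda>t. f t * g t) \<in> borel_measurable L01"
    using assms by (auto simp: sq_integrable_def)
  have "norm (f t * g t) \<le> norm ((f t)\<^sup>2 + (g t)\<^sup>2)" for t
  proof -
    have "\<bar>f t * g t\<bar> \<le> (f t)\<^sup>2 + (g t)\<^sup>2"
      using sum_squares_bound[of "f t" "g t"] sum_squares_bound[of "f t" "- g t"]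
      by (simp add: abs_le_iff)
    then show ?thesis by simp
  qed
  then show "AE t in L01. norm (f t * g t) \<le> norm ((f t)\<^sup>2 + (g t)\<^sup>2)" by simp
qed

lemma sq_integrable_add:
  assumes "sq_integrable f" "sq_integrable g"
  shows "sq_integrable (\<lambda>t. f t + g t)"
proof -
  have "integrable L01 (\<lambda>t. (f t)\<^sup>2 + 2 * (f t * g t) + (g t)\<^sup>2)"
    using assms sq_integrable_mult[OF assms] by (auto simp: sq_integrable_def)
  then have "integrable L01 (\<lambda>t. (f t + g t)\<^sup>2)"
    by (simp add: power2_sum algebra_simps)
  then show ?thesis using assms by (auto simp: sq_integrable_def)
qed

lemma sq_integrable_scale: "sq_integrable f \<Longrightarrow> sq_integrable (\<lambda>t. r * f t)"
  by (auto simp: sq_integrable_def power_mult_distrib)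

lemma sq_integrable_zero: "sq_integrable (\<lambda>_. 0)"
  by (auto simp: sq_integrable_def)

lemma finite_measure_L01: "finite_measure L01"
  by (simp add: finite_measure_lebesgue_on lmeasurable_cbox[of 0 "1::real", simplified])

lemma sq_integrable_imp_integrable:
  assumes "sq_integrable f"
  shows "integrable L01 f"
  using sq_integrable_mult[OF assms, of "\<lambda>_. 1"] finite_measure_L01
  by (simp add: sq_integrable_def finite_measure.integrable_const)

text \<open>Only the restriction of a function to the unit interval matters: values outside of it are
  arbitrary, and \<open>l2_eq\<close> ignores them.\<close>

definition l2_eq :: "(real \<Rightarrow> real) \<Rightarrow> (real \<Rightarrow> real) \<Rightarrow> bool" where
  "l2_eq f g \<longleftrightarrow> sq_integrable f \<and> sq_integrable g \<and> (AE t in L01. f t = g t)"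

lemma l2_eq_refl: "sq_integrable f \<Longrightarrow> l2_eq f f"
  by (simp add: l2_eq_def)

lemma l2_eq_sym: "l2_eq f g \<Longrightarrow> l2_eq g f"
  by (simp add: l2_eq_def eq_commute)

lemma l2_eq_trans:
  assumes "l2_eq f g" "l2_eq g h"
  shows "l2_eq f h"
proof -
  have "AE t in L01. f t = g t" "AE t in L01. g t = h t"
    using assms by (simp_all add: l2_eq_def)
  then have "AE t in L01. f t = h t"
    by eventually_elim simp
  with assms show ?thesis by (simp add: l2_eq_def)
qed

quotient_type l2 = "real \<Rightarrow> real" / partial: l2_eq
  morphisms rep_l2 abs_l2
proof (rule part_equivpI)
  show "\<exists>f. l2_eq f f" using l2_eq_refl sq_integrable_zero by blast
  show "symp l2_eq" by (rule sympI) (rule l2_eq_sym)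
  show "transp l2_eq" by (rule transpI) (rule l2_eq_trans)
qed

instantiation l2 :: real_vector
begin

lift_definition zero_l2 :: l2 is "\<lambda>_. 0"
  by (simp add: l2_eq_def sq_integrable_zero)

lift_definition plus_l2 :: "l2 \<Rightarrow> l2 \<Rightarrow> l2" is "\<lambda>f g t. f t + g t"
proof -
  fix f f' g g' assume fg: "l2_eq f f'" "l2_eq g g'"
  then have "AE t in L01. f t = f' t" "AE t in L01. g t = g' t"
    by (simp_all add: l2_eq_def)
  then have "AE t in L01. f t + g t = f' t + g' t"
    by eventually_elim simp
  with fg show "l2_eq (\<lambda>t. f t + g t) (\<lambda>t. f' t + g' t)"
    by (simp add: l2_eq_def sq_integrable_add)
qed

lift_definition scaleR_l2 :: "real \<Rightarrow> l2 \<Rightarrow> l2" is "\<lambda>r f t. r * f t"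
proof -
  fix r f f' assume f: "l2_eq f f'"
  then have "AE t in L01. f t = f' t"
    by (simp add: l2_eq_def)
  then have "AE t in L01. r * f t = r * f' t"
    by eventually_elim simp
  with f show "l2_eq (\<lambda>t. r * f t) (\<lambda>t. r * f' t)"
    by (simp add: l2_eq_def sq_integrable_scale)
qed

lift_definition uminus_l2 :: "l2 \<Rightarrow> l2" is "\<lambda>f t. - f t"
proof -
  fix f f' assume f: "l2_eq f f'"
  then have "sq_integrable (\<lambda>t. - f t)" "sq_integrable (\<lambda>t. - f' t)"
    using sq_integrable_scale[of f "-1"] sq_integrable_scale[of f' "-1"]
    by (simp_all add: l2_eq_def)
  with f show "l2_eq (\<lambda>t. - f t) (\<lambda>t. - f' t)"
    by (simp add: l2_eq_def)
qed

definition minus_l2 :: "l2 \<Rightarrow> l2 \<Rightarrow> l2" where "minus_l2 x y = x + - y"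

instance
proof
  fix x y z :: l2 and r s :: real
  show "x + y + z = x + (y + z)"
    by transfer (auto simp: l2_eq_def sq_integrable_add add.assoc)
  show "x + y = y + x"
    by transfer (auto simp: l2_eq_def sq_integrable_add add.commute)
  show "0 + x = x"
    by transfer (auto simp: l2_eq_def)
  show "- x + x = 0"
    by transfer (auto simp: l2_eq_def sq_integrable_zero)
  show "x - y = x + - y"
    by (simp add: minus_l2_def)
  show "r *\<^sub>R (x + y) = r *\<^sub>R x + r *\<^sub>R y"
    by transfer (auto simp: l2_eq_def sq_integrable_add sq_integrable_scale distrib_left)
  show "(r + s) *\<^sub>R x = r *\<^sub>R x + s *\<^sub>R x"
    by transfer (auto simp: l2_eq_def sq_integrable_add sq_integrable_scale distrib_right)
  show "r *\<^sub>R s *\<^sub>R x = (r * s) *\<^sub>R x"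
    by transfer (auto simp: l2_eq_def sq_integrable_scale mult.assoc)
  show "1 *\<^sub>R x = x"
    by transfer (auto simp: l2_eq_def)
qed

end

instantiation l2 :: real_inner
begin

lift_definition inner_l2 :: "l2 \<Rightarrow> l2 \<Rightarrow> real" is "\<lambda>f g. \<integral>t. f t * g t \<partial>L01"
proof -
  fix f f' g g' assume fg: "l2_eq f f'" "l2_eq g g'"
  then have "AE t in L01. f t = f' t" "AE t in L01. g t = g' t"
    by (simp_all add: l2_eq_def)
  then have "AE t in L01. f t * g t = f' t * g' t"
    by eventually_elim simp
  moreover have "(\<lambda>t. f t * g t) \<in> borel_measurable L01" "(\<lambda>t. f' t * g' t) \<in> borel_measurable L01"
    using fg sq_integrable_mult[THEN borel_measurable_integrable] by (simp_all add: l2_eq_def)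
  ultimately show "(\<integral>t. f t * g t \<partial>L01) = (\<integral>t. f' t * g' t \<partial>L01)"
    by (intro integral_cong_AE)
qed

definition norm_l2 :: "l2 \<Rightarrow> real" where "norm_l2 x = sqrt (inner x x)"
definition sgn_l2 :: "l2 \<Rightarrow> l2" where "sgn_l2 x = x /\<^sub>R norm x"
definition dist_l2 :: "l2 \<Rightarrow> l2 \<Rightarrow> real" where "dist_l2 x y = norm (x - y)"
definition uniformity_l2 :: "(l2 \<times> l2) filter" where
  "uniformity_l2 = (INF e\<in>{0 <..}. principal {(x, y). dist x y < e})"
definition open_l2 :: "l2 set \<Rightarrow> bool" where
  "open_l2 U \<longleftrightarrow> (\<forall>x\<in>U. \<forall>\<^sub>F (x', y) in uniformity. x' = x \<longrightarrow> y \<in> U)"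

instance
proof
  fix x y z :: l2 and r :: real
  show "dist x y = norm (x - y)" by (simp add: dist_l2_def)
  show "sgn x = x /\<^sub>R norm x" by (simp add: sgn_l2_def)
  show "uniformity = (INF e\<in>{0 <..}. principal {(x::l2, y). dist x y < e})"
    by (rule uniformity_l2_def)
  show "open U \<longleftrightarrow> (\<forall>x\<in>U. \<forall>\<^sub>F (x', y) in uniformity. x' = x \<longrightarrow> y \<in> U)" for U :: "l2 set"
    by (rule open_l2_def)
  show "inner x y = inner y x"
    by transfer (simp add: mult.commute)
  show "inner (x + y) z = inner x z + inner y z"
    by transfer (simp add: l2_eq_def distrib_right sq_integrable_mult)
  show "inner (r *\<^sub>R x) y = r * inner x y"
    by transfer (simp add: mult.assoc)
  show "0 \<le> inner x x"
    by transfer (simp add: integral_nonneg_AE)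
  show "inner x x = 0 \<longleftrightarrow> x = 0"
  proof (transfer, goal_cases)
    case (1 f)
    then have f: "sq_integrable f" by (simp add: l2_eq_def)
    have "(\<integral>t. f t * f t \<partial>L01) = 0 \<longleftrightarrow> (AE t in L01. f t * f t = 0)"
      by (rule integral_nonneg_eq_0_iff_AE) (auto simp: sq_integrable_mult f)
    then show ?case
      using f by (simp add: l2_eq_def sq_integrable_zero)
  qed
  show "norm x = sqrt (inner x x)" by (simp add: norm_l2_def)
qed

end

text \<open>\<open>representative x f\<close>: the function \<open>f\<close> belongs to the class \<open>x\<close>.\<close>

lift_definition representative :: "l2 \<Rightarrow> (real \<Rightarrow> real) \<Rightarrow> bool" is l2_eq
  by (rule ext) (blast intro: l2_eq_sym l2_eq_trans)

lemma representative_l2_eq: "representative x f \<Longrightarrow> representative x g \<Longrightarrow> l2_eq f g"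
  by transfer (blast intro: l2_eq_sym l2_eq_trans)

section \<open>Absolutely continuous elements\<close>

definition abs_continuous_on :: "real \<Rightarrow> real \<Rightarrow> (real \<Rightarrow> real) \<Rightarrow> bool" where
  "abs_continuous_on a b f \<longleftrightarrow>
    (\<forall>\<epsilon>>0. \<exists>\<delta>>0. \<forall>(n::nat) l r.
       (\<forall>i<n. a \<le> l i \<and> l i \<le> r i \<and> r i \<le> b) \<and>
       disjoint_family_on (\<lambda>i. {l i<..<r i}) {..<n} \<and>
       (\<Sum>i<n. r i - l i) < \<delta>
       \<longrightarrow> (\<Sum>i<n. \<bar>f (r i) - f (l i)\<bar>) < \<epsilon>)"

definition ac_representative :: "l2 \<Rightarrow> (real \<Rightarrow> real) \<Rightarrow> bool" where
  "ac_representative x f \<longleftrightarrow> representative x f \<and> abs_continuous_on 0 1 f"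

text \<open>By \<open>ac_representative_unique\<close> below, the value at a point of the unit interval does not
  depend on the representative that is picked.\<close>

definition point_value :: "l2 \<Rightarrow> real \<Rightarrow> real" where
  "point_value x t = (SOME f. ac_representative x f) t"

lemma abs_continuous_on_imp_continuous_on:
  assumes "abs_continuous_on a b f"
  shows "continuous_on {a..b} f"
  unfolding continuous_on_iff
proof (intro ballI allI impI)
  fix x e :: real assume x: "x \<in> {a..b}" and "e > 0"
  from assms[unfolded abs_continuous_on_def, rule_format, OF \<open>e > 0\<close>]
  obtain d where d: "d > 0" and D: "\<forall>(n::nat) l r.
       (\<forall>i<n. a \<le> l i \<and> l i \<le> r i \<and> r i \<le> b) \<and>
       disjoint_family_on (\<lambda>i. {l i<..<r i}) {..<n} \<and>
       (\<Sum>i<n. r i - l i) < d \<longrightarrow> (\<Sum>i<n. \<bar>f (r i) - f (l i)\<bar>) < e"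
    by (elim exE conjE) (rule that)
  have "dist (f y) (f x) < e" if "y \<in> {a..b}" "dist y x < d" for y
  proof -
    have "(\<Sum>i<1::nat. \<bar>f (max x y) - f (min x y)\<bar>) < e"
      by (rule D[THEN spec, of 1, THEN spec, of "\<lambda>_. min x y", THEN spec, of "\<lambda>_. max x y", THEN mp])
        (use x that in \<open>simp add: disjoint_family_on_def dist_real_def min_def max_def abs_if split: if_splits\<close>)
    moreover have "\<bar>f (max x y) - f (min x y)\<bar> = \<bar>f y - f x\<bar>"
      by (cases "x \<le> y") (auto simp: max_def min_def)
    ultimately show ?thesis by (simp add: dist_real_def)
  qed
  then show "\<exists>d>0. \<forall>y\<in>{a..b}. dist y x < d \<longrightarrow> dist (f y) (f x) < e"
    using d by blast
qed

lemma ac_representative_unique: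
  assumes "ac_representative x f" "ac_representative x g" "t \<in> {0..1}"
  shows "f t = g t"
proof -
  have c: "continuous_on {0..1} f" "continuous_on {0..1} g"
    using assms by (auto simp: ac_representative_def abs_continuous_on_imp_continuous_on)
  have "representative x f" "representative x g"
    using assms by (auto simp: ac_representative_def)
  then have ae: "AE t in L01. f t = g t"
    using representative_l2_eq by (auto simp: l2_eq_def)
  have cd: "continuous_on {0..1} (\<lambda>t. \<bar>f t - g t\<bar>)" by (intro continuous_intros c)
  have "integral {0..1} (\<lambda>t. \<bar>f t - g t\<bar>) = 0"
  proof -
    have "integrable L01 (\<lambda>t. \<bar>f t - g t\<bar>)"
      using absolutely_integrable_continuous_real[OF cd]
      by (simp add: set_integrable_def integrable_restrict_space)
    then have "integral {0..1} (\<lambda>t. \<bar>f t - g t\<bar>) = integral\<^sup>L L01 (\<lambda>t. \<bar>f t - g t\<bar>)"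
      by (simp add: lebesgue_integral_eq_integral)
    also have "\<dots> = 0" by (rule integral_eq_zero_AE) (use ae in auto)
    finally show ?thesis .
  qed
  then have "((\<lambda>t. \<bar>f t - g t\<bar>) has_integral 0) (cbox 0 1)"
    using integrable_continuous_real[OF cd] by (simp add: has_integral_iff)
  then have "\<bar>f t - g t\<bar> = 0"
    by (rule has_integral_0_cbox_imp_0[rotated 2]) (use cd assms in auto)
  then show ?thesis by simp
qed

text \<open>An absolutely continuous function is differentiable almost everywhere, so \<open>g\<close> below is
  its a.e. derivative, unique up to null sets.\<close>

definition H_space :: "l2 set" where
  "H_space = {x. \<exists>f g. ac_representative x f \<and> sq_integrable g \<and>
             (AE t in L01. (f has_real_derivative g t) (at t within {0..1}))}"

section \<open>Set-valued operators\<close>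

definition gra :: "('a \<Rightarrow> 'a set) \<Rightarrow> ('a \<times> 'a) set" where
  "gra A = {(x, x'). x' \<in> A x}"

definition op_inverse :: "('a \<Rightarrow> 'a set) \<Rightarrow> 'a \<Rightarrow> 'a set" where
  "op_inverse A = (\<lambda>x'. {x. (x, x') \<in> gra A})"

text \<open>The sum is empty, hence has no graph over \<open>x\<close>, unless \<open>x\<close> is in both domains.\<close>

definition op_sum :: "('a::plus \<Rightarrow> 'a set) \<Rightarrow> ('a \<Rightarrow> 'a set) \<Rightarrow> 'a \<Rightarrow> 'a set" where
  "op_sum A B = (\<lambda>x. {u + v |u v. u \<in> A x \<and> v \<in> B x})"

definition op_adjoint :: "('a::real_inner \<Rightarrow> 'a set) \<Rightarrow> 'a \<Rightarrow> 'a set" where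
  "op_adjoint A = (\<lambda>x. {x'. (x', - x) \<in> (gra A)\<^sup>\<bottom>})"

definition fitzpatrick :: "('a::real_inner \<Rightarrow> 'a set) \<Rightarrow> 'a \<times> 'a \<Rightarrow> ereal" where
  "fitzpatrick A = (\<lambda>(x, x'). SUP (a, a')\<in>gra A. ereal (x \<bullet> a' + a \<bullet> x' - a \<bullet> a'))"

text \<open>For operators with nonempty graph the Fitzpatrick function never takes the value
  \<open>- \<infinity>\<close>, so the sum below is the usual one on extended reals greater than \<open>- \<infinity>\<close>.\<close>

definition partial_inf_conv ::
  "('a::real_vector \<times> 'a \<Rightarrow> ereal) \<Rightarrow> ('a \<times> 'a \<Rightarrow> ereal) \<Rightarrow> 'a \<times> 'a \<Rightarrow> ereal"
  (infixl \<open>\<box>\<^sub>2\<close> 65) where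
  "F1 \<box>\<^sub>2 F2 = (\<lambda>(x, x'). INF y'. F1 (x, x' - y') + F2 (x, y'))"

definition indicator_fun :: "'b set \<Rightarrow> 'b \<Rightarrow> ereal" where
  "indicator_fun C z = (if z \<in> C then 0 else \<infinity>)"

section \<open>The Volterra operator\<close>

lemma sq_integrable_imp_set_integrable:
  assumes "sq_integrable f" "t \<in> {0..1}"
  shows "set_integrable lebesgue {0..t} f"
proof (rule set_integrable_subset)
  show "set_integrable lebesgue {0..1} f"
    using sq_integrable_imp_integrable[OF assms(1)]
    by (simp add: set_integrable_def integrable_restrict_space)
qed (use assms in auto)

lemma sq_integrable_volterra:
  assumes "sq_integrable f"
  shows "sq_integrable (\<lambda>t. LINT s:{0..t}|lebesgue. f s)"
proof -
  note f = sq_integrable_imp_set_integrable[OF assms]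
  have eq: "integral {0..t} f = (LINT s:{0..t}|lebesgue. f s)" if "t \<in> {0..1}" for t
    using set_lebesgue_integral_eq_integral(2)[OF f[OF that]] by simp
  have "f integrable_on {0..1}"
    by (rule set_lebesgue_integral_eq_integral(1)) (rule f, simp)
  then have "continuous_on {0..1} (\<lambda>t. integral {0..t} f)"
    by (rule indefinite_integral_continuous_1)
  then have c: "continuous_on {0..1} (\<lambda>t. LINT s:{0..t}|lebesgue. f s)"
    by (rule continuous_on_eq) (rule eq)
  have "integrable L01 (\<lambda>t. (LINT s:{0..t}|lebesgue. f s)\<^sup>2)"
    using absolutely_integrable_continuous_real[OF continuous_on_power[OF c, of 2]]
    by (simp add: set_integrable_def integrable_restrict_space)
  moreover have "(\<lambda>t. LINT s:{0..t}|lebesgue. f s) \<in> borel_measurable L01"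
    by (rule continuous_imp_measurable_on_sets_lebesgue[OF c]) simp
  ultimately show ?thesis by (simp add: sq_integrable_def)
qed

lemma volterra_cong:
  assumes "l2_eq f g" "t \<in> {0..1}"
  shows "(LINT s:{0..t}|lebesgue. f s) = (LINT s:{0..t}|lebesgue. g s)"
  unfolding set_lebesgue_integral_def
proof (rule integral_cong_AE)
  have "set_integrable lebesgue {0..t} f" "set_integrable lebesgue {0..t} g"
    using assms by (auto simp: l2_eq_def intro!: sq_integrable_imp_set_integrable)
  then show "(\<lambda>s. indicator {0..t} s *\<^sub>R f s) \<in> borel_measurable lebesgue"
    "(\<lambda>s. indicator {0..t} s *\<^sub>R g s) \<in> borel_measurable lebesgue"
    unfolding set_integrable_def by auto
  have "AE s in lebesgue. s \<in> {0..1} \<longrightarrow> f s = g s"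
    using assms(1) by (simp add: l2_eq_def AE_restrict_space_iff)
  then show "AE s in lebesgue. indicator {0..t} s *\<^sub>R f s = indicator {0..t} s *\<^sub>R g s"
    by (rule eventually_mono) (use assms(2) in \<open>auto simp: indicator_def\<close>)
qed

lift_definition volterra :: "l2 \<Rightarrow> l2" is "\<lambda>f t. LINT s:{0..t}|lebesgue. f s"
proof -
  fix f g assume fg: "l2_eq f g"
  have "AE t in L01. (LINT s:{0..t}|lebesgue. f s) = (LINT s:{0..t}|lebesgue. g s)"
    by (rule AE_I2) (use fg volterra_cong in auto)
  with fg show "l2_eq (\<lambda>t. LINT s:{0..t}|lebesgue. f s) (\<lambda>t. LINT s:{0..t}|lebesgue. g s)"
    unfolding l2_eq_def by (intro conjI sq_integrable_volterra) blast+
qed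

definition T_op :: "l2 \<Rightarrow> l2 set" where
  "T_op = op_inverse (\<lambda>x. {volterra x})"

end

theory Submission
  imports Defs
begin

text \<open>Write \<open>V\<close> for the Volterra operator and 1 for the constant function. The operator theory rests
  on two facts. Integration by parts gives \<open>V u \<bullet> w + u \<bullet> V w = (u \<bullet> 1) (w \<bullet> 1)\<close>
  (\<open>volterra_inner_by_parts\<close>), so the adjoint of \<open>V\<close> is \<open>w \<mapsto> (w \<bullet> 1) 1 - V w\<close>, and both \<open>V\<close> and its
  adjoint have the quadratic form \<open>(u \<bullet> 1)\<^sup>2 / 2\<close>. And \<open>V u\<close> is a constant only for \<open>u = 0\<close>
  (\<open>volterra_eq_const\<close>).

  The graphs of \<open>T\<close> and of its adjoint are parametrised by \<open>V\<close> and by the adjoint of \<open>V\<close>. Hence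
  each of their Fitzpatrick functions is a supremum over \<open>u\<close> of a linear functional \<open>z \<bullet> u\<close> minus
  \<open>(u \<bullet> 1)\<^sup>2 / 2\<close>; it is \<open>c\<^sup>2 / 2\<close> if \<open>z\<close> is the constant \<open>c\<close> and infinite if \<open>z\<close> is not constant
  (\<open>SUP_linear_minus_square\<close>). In the partial inf-convolution both terms are finite only if the second
  argument is 0 and \<open>x = d - V y\<close>; then the two constants are \<open>x(1)\<close> and \<open>x(0)\<close>, so the infimum is over
  equal values (\<open>fitzpatrick_T_plus_fitzpatrick_T_adjoint\<close>). The operator sum, on the other hand, is
  zero on its domain, the primitives that vanish at both ends. The domain is dense, and so its
  Fitzpatrick function is the indicator function of \<open>X \<times> {0}\<close> (\<open>fitzpatrick_sum_T_adjoint\<close>).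

  The real analysis behind this is the description of \<open>H_space\<close> as the set of all \<open>d + V y\<close>
  (\<open>H_space_eq\<close>) and the integration by parts. Both need that a primitive of a square-integrable
  function is absolutely continuous and has that function as derivative almost everywhere, and
  conversely that an absolutely continuous function is recovered from its almost everywhere derivative
  by integration. The converse is proved directly with gauges (\<open>abs_continuous_on_has_integral\<close>).\<close>

section \<open>Absolute continuity and the fundamental theorem of calculus\<close>

text \<open>The definition of absolute continuity speaks of families indexed by an initial segment of the
  natural numbers. Below it is applied to the tagged intervals of a division, hence this version
  for arbitrary finite index sets.\<close>

lemma abs_continuous_on_finite_family:
  assumes "abs_continuous_on a b f" "\<epsilon> > 0"
  obtains \<delta> where "\<delta> > 0"
    "\<And>I (l :: 'i \<Rightarrow> real) r. \<lbrakk>finite I; \<And>i. i \<in> I \<Longrightarrow> a \<le> l i \<and> l i \<le> r i \<and> r i \<le> b;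
        disjoint_family_on (\<lambda>i. {l i<..<r i}) I; (\<Sum>i\<in>I. r i - l i) < \<delta>\<rbrakk>
      \<Longrightarrow> (\<Sum>i\<in>I. \<bar>f (r i) - f (l i)\<bar>) < \<epsilon>"
proof -
  obtain \<delta> where "\<delta> > 0" and \<delta>: "\<And>(n::nat) l r.
       (\<forall>i<n. a \<le> l i \<and> l i \<le> r i \<and> r i \<le> b) \<and>
       disjoint_family_on (\<lambda>i. {l i<..<r i}) {..<n} \<and>
       (\<Sum>i<n. r i - l i) < \<delta> \<Longrightarrow> (\<Sum>i<n. \<bar>f (r i) - f (l i)\<bar>) < \<epsilon>"
    using assms unfolding abs_continuous_on_def by meson
  show thesis
  proof (rule that[OF \<open>\<delta> > 0\<close>])
    fix I and l r :: "'i \<Rightarrow> real"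
    assume I: "finite I" "\<And>i. i \<in> I \<Longrightarrow> a \<le> l i \<and> l i \<le> r i \<and> r i \<le> b"
      "disjoint_family_on (\<lambda>i. {l i<..<r i}) I" "(\<Sum>i\<in>I. r i - l i) < \<delta>"
    obtain h where h: "bij_betw h {..<card I} I"
      using ex_bij_betw_nat_finite[OF I(1)] by (auto simp: atLeast0LessThan)
    have reindex: "(\<Sum>i<card I. \<phi> (h i)) = (\<Sum>i\<in>I. \<phi> i)" for \<phi> :: "'i \<Rightarrow> real"
      using h by (rule sum.reindex_bij_betw)
    have "disjoint_family_on (\<lambda>i. {l (h i)<..<r (h i)}) {..<card I}"
      unfolding disjoint_family_on_def
    proof (intro ballI impI)
      fix i j assume "i \<in> {..<card I}" "j \<in> {..<card I}" "i \<noteq> j"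
      then have "h i \<in> I" "h j \<in> I" "h i \<noteq> h j"
        using h by (auto simp: bij_betw_def inj_on_def)
      then show "{l (h i)<..<r (h i)} \<inter> {l (h j)<..<r (h j)} = {}"
        using I(3) unfolding disjoint_family_on_def by blast
    qed
    moreover have "\<forall>i<card I. a \<le> l (h i) \<and> l (h i) \<le> r (h i) \<and> r (h i) \<le> b"
      using h I(2) by (auto simp: bij_betw_def)
    ultimately have "(\<Sum>i<card I. \<bar>f (r (h i)) - f (l (h i))\<bar>) < \<epsilon>"
      using \<delta>[where n="card I" and l="l \<circ> h" and r="r \<circ> h"] reindex[of "\<lambda>i. r i - l i"] I(4) by simp
    then show "(\<Sum>i\<in>I. \<bar>f (r i) - f (l i)\<bar>) < \<epsilon>"
      using reindex[of "\<lambda>i. \<bar>f (r i) - f (l i)\<bar>"] by simp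
  qed
qed

lemma measure_disjoint_open_intervals:
  fixes l r :: "'i \<Rightarrow> real"
  assumes "finite I" "\<And>i. i \<in> I \<Longrightarrow> l i \<le> r i" "disjoint_family_on (\<lambda>i. {l i<..<r i}) I"
  shows "measure lebesgue (\<Union>i\<in>I. {l i<..<r i}) = (\<Sum>i\<in>I. r i - l i)"
proof -
  have "measure lebesgue (\<Union>i\<in>I. {l i<..<r i}) = (\<Sum>i\<in>I. measure lebesgue {l i<..<r i})"
    by (rule measure_finite_Union) (use assms in \<open>auto simp: emeasure_lborel_Ioo\<close>)
  also have "\<dots> = (\<Sum>i\<in>I. r i - l i)"
    by (rule sum.cong) (use assms(2) in \<open>auto simp: measure_completion\<close>)
  finally show ?thesis .
qed

lemma sum_lengths_le_measure:
  fixes l r :: "'i \<Rightarrow> real"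
  assumes "finite I" "\<And>i. i \<in> I \<Longrightarrow> l i \<le> r i" "disjoint_family_on (\<lambda>i. {l i<..<r i}) I"
    and "U \<in> lmeasurable" "\<And>i. i \<in> I \<Longrightarrow> {l i<..<r i} \<subseteq> U"
  shows "(\<Sum>i\<in>I. r i - l i) \<le> measure lebesgue U"
proof -
  have "measure lebesgue (\<Union>i\<in>I. {l i<..<r i}) \<le> measure lebesgue U"
    by (rule measure_mono_fmeasurable) (use assms in auto)
  also have "measure lebesgue (\<Union>i\<in>I. {l i<..<r i}) = (\<Sum>i\<in>I. r i - l i)"
    by (rule measure_disjoint_open_intervals) (use assms in auto)
  finally show ?thesis .
qed

text \<open>The fundamental theorem of calculus for absolutely continuous functions, in the gauge integral.
  The gauge treats the two kinds of tags differently. At a tag outside \<open>N\<close> it makes the interval so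
  small that the derivative controls the increment of \<open>f\<close> up to \<open>c\<close> times the length. At a tag in \<open>N\<close>
  it keeps the interval inside an open set \<open>U\<close> that contains \<open>N\<close> and has small measure, so that these
  intervals have small total length and absolute continuity makes their total increment small.\<close>

lemma abs_continuous_on_has_integral:
  fixes f g :: "real \<Rightarrow> real"
  assumes ac: "abs_continuous_on a b f" and "a \<le> b" and N: "negligible N"
    and der: "\<And>x. x \<in> {a..b} - N \<Longrightarrow> (f has_real_derivative g x) (at x within {a..b})"
  shows "(g has_integral f b - f a) {a..b}"
proof -
  define g' where "g' x = (if x \<in> N then 0 else g x)" for x
  have "(g' has_integral f b - f a) {a..b}"
    unfolding has_integral_real
  proof (intro allI impI)
    fix \<epsilon> :: real assume "\<epsilon> > 0"
    obtain \<delta> where "\<delta> > 0" and \<delta>: "\<And>I (l :: real \<times> real set \<Rightarrow> real) r.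
        \<lbrakk>finite I; \<And>i. i \<in> I \<Longrightarrow> a \<le> l i \<and> l i \<le> r i \<and> r i \<le> b;
        disjoint_family_on (\<lambda>i. {l i<..<r i}) I; (\<Sum>i\<in>I. r i - l i) < \<delta>\<rbrakk>
      \<Longrightarrow> (\<Sum>i\<in>I. \<bar>f (r i) - f (l i)\<bar>) < \<epsilon>/2"
      by (rule abs_continuous_on_finite_family[OF ac half_gt_zero[OF \<open>\<epsilon> > 0\<close>]]) blast
    obtain U where "open U" "N \<subseteq> U" "U \<in> lmeasurable" and U: "measure lebesgue U < \<delta>"
    proof -
      have "N \<in> sets lebesgue" using N by (simp add: negligible_iff_null_sets null_sets_def)
      then obtain U where U: "open U" "N \<subseteq> U" "U - N \<in> lmeasurable" "emeasure lebesgue (U - N) < ennreal \<delta>"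
        using sets_lebesgue_outer_open \<open>\<delta> > 0\<close> by metis
      have NU: "U = (U - N) \<union> N" using U by auto
      have nm: "N \<in> lmeasurable" using N by (rule negligible_imp_measurable)
      have "U \<in> lmeasurable" by (subst NU) (intro fmeasurable.Un U nm)
      moreover have "measure lebesgue U = measure lebesgue (U - N)"
        by (metis N U(3) measure_Diff_null_set fmeasurableD calculation negligible_iff_null_sets)
      moreover have "measure lebesgue (U - N) < \<delta>"
        using U(3,4) \<open>\<delta> > 0\<close> by (simp add: emeasure_eq_measure2 ennreal_less_iff)
      ultimately show thesis using U that by metis
    qed
    \<comment> \<open>The extra 1 only avoids dividing by zero when the interval is degenerate.\<close>
    define D where "D = b - a + 1"
    have "D > 0" using \<open>a \<le> b\<close> by (simp add: D_def)
    define c where "c = \<epsilon> / (2 * D)"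
    have "c > 0" using \<open>\<epsilon> > 0\<close> \<open>D > 0\<close> by (simp add: c_def)
    have "\<forall>x. \<exists>d. d > 0 \<and> (x \<in> N \<longrightarrow> ball x d \<subseteq> U) \<and>
        (x \<in> {a..b} - N \<longrightarrow> (\<forall>y\<in>{a..b}. \<bar>y - x\<bar> < d \<longrightarrow> \<bar>f y - f x - g x * (y - x)\<bar> \<le> c * \<bar>y - x\<bar>))"
      (is "\<forall>x. \<exists>d. ?Q x d")
    proof
      fix x
      show "\<exists>d. ?Q x d"
      proof (cases "x \<in> {a..b} - N")
        case True
        then obtain d where "d > 0" "\<forall>y\<in>{a..b}. norm (y - x) < d \<longrightarrow>
            norm (f y - f x - g x * (y - x)) \<le> c * norm (y - x)"
          using der[OF True] \<open>c > 0\<close> unfolding has_field_derivative_def has_derivative_within_alt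
          by blast
        then show ?thesis using True by auto
      next
        case False
        show ?thesis
        proof (cases "x \<in> N")
          case True
          then obtain d where "d > 0" "ball x d \<subseteq> U"
            using \<open>open U\<close> \<open>N \<subseteq> U\<close> openE by blast
          then show ?thesis using True by auto
        next
          case outside: False
          then show ?thesis using False by (intro exI[of _ 1]) auto
        qed
      qed
    qed
    from choice[OF this] obtain d where "\<forall>x. ?Q x (d x)" ..
    then have d0: "d x > 0" and dU: "x \<in> N \<Longrightarrow> ball x (d x) \<subseteq> U"
      and d: "\<lbrakk>x \<in> {a..b} - N; y \<in> {a..b}; \<bar>y - x\<bar> < d x\<rbrakk>
        \<Longrightarrow> \<bar>f y - f x - g x * (y - x)\<bar> \<le> c * \<bar>y - x\<bar>" for x y
      by blast+
    show "\<exists>\<gamma>. gauge \<gamma> \<and> (\<forall>\<D>. \<D> tagged_division_of {a..b} \<and> \<gamma> fine \<D> \<longrightarrow>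
        norm ((\<Sum>(x, k)\<in>\<D>. measure lborel k *\<^sub>R g' x) - (f b - f a)) < \<epsilon>)"
    proof (intro exI conjI allI impI)
      show "gauge (\<lambda>x. ball x (d x))" using d0 by (simp add: gauge_def)
      fix p assume "p tagged_division_of {a..b} \<and> (\<lambda>x. ball x (d x)) fine p"
      then have p: "p tagged_division_of {a..b}" and fine: "(\<lambda>x. ball x (d x)) fine p" by auto
      note pD = tagged_division_ofD[OF p]
      let ?l = "\<lambda>i::real \<times> real set. Inf (snd i)" and ?r = "\<lambda>i::real \<times> real set. Sup (snd i)"
      have K: "snd i = {?l i..?r i} \<and> fst i \<in> {?l i..?r i} \<and> a \<le> ?l i \<and> ?l i \<le> ?r i \<and> ?r i \<le> b
          \<and> snd i \<subseteq> ball (fst i) (d (fst i))"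
        if "i \<in> p" for i
      proof -
        obtain x K where i: "i = (x, K)" by (cases i)
        with that have xK: "(x, K) \<in> p" by simp
        then obtain u v where K: "K = {u..v}" using pD(4)[OF xK] by (auto simp: box_real)
        have "x \<in> K" "K \<subseteq> {a..b}" "K \<subseteq> ball x (d x)"
          using pD(2,3)[OF xK] fineD[OF fine xK] by auto
        then show ?thesis using i K by auto
      qed
      let ?e = "\<lambda>i. measure lborel (snd i) * g' (fst i) - (f (?r i) - f (?l i))"
      have content: "measure lborel (snd i) = ?r i - ?l i" if "i \<in> p" for i
        using K[OF that] by (metis content_real)
      have disj: "disjoint_family_on (\<lambda>i. {?l i<..<?r i}) p"
        unfolding disjoint_family_on_def
      proof (intro ballI impI)
        fix i j assume ij: "i \<in> p" "j \<in> p" "i \<noteq> j"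
        then have "interior (snd i) \<inter> interior (snd j) = {}"
          using pD(5)[of "fst i" "snd i" "fst j" "snd j"] by auto
        moreover have "interior (snd i) = {?l i<..<?r i}" "interior (snd j) = {?l j<..<?r j}"
          using K[OF ij(1)] K[OF ij(2)] by (metis interior_atLeastAtMost_real)+
        ultimately show "{?l i<..<?r i} \<inter> {?l j<..<?r j} = {}" by simp
      qed
      define P where "P = {i \<in> p. fst i \<in> N}"
      have "finite p" "P \<subseteq> p" by (auto simp: P_def pD)
      then have "finite P" using finite_subset by blast
      have good: "\<bar>?e i\<bar> \<le> c * measure lborel (snd i)" if "i \<in> p - P" for i
      proof -
        have i: "i \<in> p" "fst i \<in> {a..b} - N" using that K[of i] by (auto simp: P_def)
        note Ki = K[OF i(1)]
        have "?l i \<in> snd i" "?r i \<in> snd i" using Ki by (metis atLeastAtMost_iff order_refl)+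
        then have "\<bar>?l i - fst i\<bar> < d (fst i)" "\<bar>?r i - fst i\<bar> < d (fst i)"
          using Ki by (auto simp: dist_real_def abs_minus_commute)
        then have "\<bar>f (?l i) - f (fst i) - g (fst i) * (?l i - fst i)\<bar> \<le> c * \<bar>?l i - fst i\<bar>"
          "\<bar>f (?r i) - f (fst i) - g (fst i) * (?r i - fst i)\<bar> \<le> c * \<bar>?r i - fst i\<bar>"
          using d[OF i(2), of "?l i"] d[OF i(2), of "?r i"] Ki by auto
        moreover have "c * \<bar>?l i - fst i\<bar> + c * \<bar>?r i - fst i\<bar> = c * (?r i - ?l i)"
          using Ki by (simp add: abs_if algebra_simps)
        moreover have "?e i = (f (?l i) - f (fst i) - g (fst i) * (?l i - fst i))
            - (f (?r i) - f (fst i) - g (fst i) * (?r i - fst i))"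
          unfolding content[OF i(1)] using i(2) by (simp add: g'_def algebra_simps)
        ultimately show ?thesis unfolding content[OF i(1)] by linarith
      qed
      have "(\<Sum>i\<in>P. \<bar>f (?r i) - f (?l i)\<bar>) < \<epsilon>/2"
      proof (rule \<delta>)
        show disjP: "disjoint_family_on (\<lambda>i. {?l i<..<?r i}) P"
          using disj \<open>P \<subseteq> p\<close> by (rule disjoint_family_on_mono[rotated])
        have "{?l i<..<?r i} \<subseteq> U" if "i \<in> P" for i
        proof -
          have "{?l i<..<?r i} \<subseteq> snd i" using that K[of i] unfolding P_def by force
          then show ?thesis using that K[of i] dU[of "fst i"] unfolding P_def by blast
        qed
        then have "(\<Sum>i\<in>P. ?r i - ?l i) \<le> measure lebesgue U"
          by (intro sum_lengths_le_measure \<open>finite P\<close> disjP \<open>U \<in> lmeasurable\<close>)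
            (use K \<open>P \<subseteq> p\<close> in auto)
        then show "(\<Sum>i\<in>P. ?r i - ?l i) < \<delta>" using U by simp
      qed (use \<open>finite P\<close> K \<open>P \<subseteq> p\<close> in auto)
      moreover have "\<bar>?e i\<bar> = \<bar>f (?r i) - f (?l i)\<bar>" if "i \<in> P" for i
        using that by (simp add: P_def g'_def abs_minus_commute)
      ultimately have bad: "(\<Sum>i\<in>P. \<bar>?e i\<bar>) < \<epsilon>/2" by simp
      have "(\<Sum>i\<in>p - P. \<bar>?e i\<bar>) \<le> (\<Sum>i\<in>p - P. c * measure lborel (snd i))"
        by (rule sum_mono) (rule good)
      also have "\<dots> \<le> (\<Sum>i\<in>p. c * measure lborel (snd i))"
        by (rule sum_mono2) (use \<open>finite p\<close> \<open>c > 0\<close> in auto)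
      also have "\<dots> = c * (b - a)"
        using additive_content_tagged_division[of p a b] p \<open>a \<le> b\<close>
        by (simp add: case_prod_beta' flip: sum_distrib_left)
      also have "\<dots> \<le> c * D" using \<open>c > 0\<close> by (simp add: D_def)
      also have "\<dots> = \<epsilon>/2" using \<open>D > 0\<close> by (simp add: c_def)
      finally have "(\<Sum>i\<in>p - P. \<bar>?e i\<bar>) \<le> \<epsilon>/2" .
      moreover have "(\<Sum>i\<in>p. \<bar>?e i\<bar>) = (\<Sum>i\<in>p - P. \<bar>?e i\<bar>) + (\<Sum>i\<in>P. \<bar>?e i\<bar>)"
        using \<open>finite p\<close> \<open>P \<subseteq> p\<close> by (rule sum.subset_diff[rotated])
      ultimately have "(\<Sum>i\<in>p. \<bar>?e i\<bar>) < \<epsilon>" using bad by simp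
      then have "\<bar>\<Sum>i\<in>p. ?e i\<bar> < \<epsilon>" by (rule le_less_trans[OF sum_abs])
      moreover have "(\<Sum>(x, k)\<in>p. measure lborel k *\<^sub>R g' x) - (f b - f a) = (\<Sum>i\<in>p. ?e i)"
        using additive_tagged_division_1[OF \<open>a \<le> b\<close> p, of f]
        by (simp add: case_prod_beta' sum_subtractf)
      ultimately show "norm ((\<Sum>(x, k)\<in>p. measure lborel k *\<^sub>R g' x) - (f b - f a)) < \<epsilon>"
        by (simp only: real_norm_def)
    qed
  qed
  then show ?thesis
    by (rule has_integral_spike[OF N, rotated]) (auto simp: g'_def)
qed

text \<open>Lebesgue differentiation in the form of a derivative. The library result
  \<open>integrable_ccontinuous_explicit\<close> averages over intervals to the right of the point; applied to
  the reflected function, it also gives the averages to the left.\<close>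

lemma indefinite_integral_has_derivative_off_negligible:
  fixes f :: "real \<Rightarrow> real"
  assumes f: "f absolutely_integrable_on {a..b}"
  obtains N where "negligible N"
    "\<And>x. x \<in> {a..b} - N \<Longrightarrow> ((\<lambda>t. integral {a..t} f) has_real_derivative f x) (at x within {a..b})"
proof -
  define h where "h x = (if x \<in> {a..b} then f x else 0)" for x
  have hint: "h integrable_on UNIV"
    unfolding h_def integrable_restrict_UNIV using f by (rule set_lebesgue_integral_eq_integral(1))
  have h: "h integrable_on cbox u v" for u v
    using integrable_on_subcbox[OF hint, of u v] by simp
  then have h': "(\<lambda>x. h (- x)) integrable_on cbox u v" for u v
    using integrable_reflect[of h "-u" "-v"] by simp
  obtain N1 where N1: "negligible N1" "\<And>x e. \<lbrakk>x \<notin> N1; 0 < e\<rbrakk> \<Longrightarrow>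
      \<exists>d>0. \<forall>k. 0 < k \<and> k < d \<longrightarrow> \<bar>integral {x..x+k} h / k - h x\<bar> < e"
    using integrable_ccontinuous_explicit[OF h] by (auto simp: divide_inverse_commute)
  obtain N2 where N2: "negligible N2" "\<And>x e. \<lbrakk>x \<notin> N2; 0 < e\<rbrakk> \<Longrightarrow>
      \<exists>d>0. \<forall>k. 0 < k \<and> k < d \<longrightarrow> \<bar>integral {x..x+k} (\<lambda>x. h (- x)) / k - h (- x)\<bar> < e"
    using integrable_ccontinuous_explicit[OF h'] by (auto simp: divide_inverse_commute)
  have "negligible (uminus ` N2)"
    by (rule negligible_differentiable_image_negligible[OF _ N2(1)])
      (auto intro!: derivative_intros simp: differentiable_on_def)
  then have neg: "negligible (N1 \<union> uminus ` N2)" using N1 by auto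
  show thesis
  proof (rule that[OF neg])
    fix x assume x: "x \<in> {a..b} - (N1 \<union> uminus ` N2)"
    then have xN: "x \<notin> N1" "- x \<notin> N2" by (auto simp: image_iff)
    have hx: "h x = f x" using x by (simp add: h_def)
    have diff: "integral {u..v} h = integral {a..v} f - integral {a..u} f"
      if "a \<le> u" "u \<le> v" "v \<le> b" for u v
    proof -
      have "f integrable_on {a..b}" using f by (simp add: set_lebesgue_integral_eq_integral(1))
      then have "f integrable_on {a..v}" using that by (auto elim: integrable_on_subinterval)
      then have "integral {a..u} f + integral {u..v} f = integral {a..v} f"
        using that by (intro Henstock_Kurzweil_Integration.integral_combine) auto
      moreover have "integral {u..v} h = integral {u..v} f"
        by (rule integral_cong) (use that in \<open>auto simp: h_def\<close>)
      ultimately show ?thesis by simp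
    qed
    show "((\<lambda>t. integral {a..t} f) has_real_derivative f x) (at x within {a..b})"
      unfolding has_field_derivative_def has_derivative_within_alt
    proof (intro conjI allI impI)
      fix e :: real assume "e > 0"
      obtain d1 where "d1 > 0" and d1: "\<And>k. 0 < k \<Longrightarrow> k < d1 \<Longrightarrow> \<bar>integral {x..x+k} h / k - f x\<bar> < e"
        using N1(2)[OF xN(1) \<open>e > 0\<close>] hx by auto
      obtain d2 where "d2 > 0" and d2: "\<And>k. 0 < k \<Longrightarrow> k < d2 \<Longrightarrow>
          \<bar>integral {-x..-x+k} (\<lambda>x. h (- x)) / k - f x\<bar> < e"
        using N2(2)[OF xN(2) \<open>e > 0\<close>] hx by auto
      have "\<bar>integral {a..y} f - integral {a..x} f - f x * (y - x)\<bar> \<le> e * \<bar>y - x\<bar>"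
        if y: "y \<in> {a..b}" "\<bar>y - x\<bar> < min d1 d2" for y
      proof (cases y x rule: linorder_cases)
        case equal then show ?thesis by simp
      next
        case greater
        then have "\<bar>integral {x..y} h / (y - x) - f x\<bar> < e" using d1[of "y - x"] y by simp
        then have "\<bar>integral {x..y} h / (y - x) - f x\<bar> * (y - x) \<le> e * (y - x)"
          using greater by (intro mult_right_mono) auto
        moreover have "\<bar>integral {x..y} h / (y - x) - f x\<bar> * (y - x) = \<bar>integral {x..y} h - f x * (y - x)\<bar>"
        proof -
          have "\<bar>integral {x..y} h / (y - x) - f x\<bar> * (y - x)
              = \<bar>(integral {x..y} h / (y - x) - f x) * (y - x)\<bar>"
            using greater by (simp add: abs_mult)
          then show ?thesis using greater by (simp add: left_diff_distrib)
        qed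
        ultimately show ?thesis using diff[of x y] greater x y by simp
      next
        case less
        have "integral {-x..-y} (\<lambda>x. h (- x)) = integral {y..x} h"
          by (rule Henstock_Kurzweil_Integration.integral_reflect_real)
        then have "\<bar>integral {y..x} h / (x - y) - f x\<bar> < e" using d2[of "x - y"] y less by simp
        then have "\<bar>integral {y..x} h / (x - y) - f x\<bar> * (x - y) \<le> e * (x - y)"
          using less by (intro mult_right_mono) auto
        moreover have "\<bar>integral {y..x} h / (x - y) - f x\<bar> * (x - y) = \<bar>integral {y..x} h - f x * (x - y)\<bar>"
        proof -
          have "\<bar>integral {y..x} h / (x - y) - f x\<bar> * (x - y)
              = \<bar>(integral {y..x} h / (x - y) - f x) * (x - y)\<bar>"
            using less by (simp add: abs_mult)
          then show ?thesis using less by (simp add: left_diff_distrib)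
        qed
        moreover have "\<bar>integral {a..y} f - integral {a..x} f - f x * (y - x)\<bar>
            = \<bar>integral {y..x} h - f x * (x - y)\<bar>"
          using diff[of y x] less x y by (simp add: abs_if algebra_simps)
        ultimately show ?thesis using less by simp
      qed
      then show "\<exists>d>0. \<forall>y\<in>{a..b}. norm (y - x) < d \<longrightarrow>
          norm (integral {a..y} f - integral {a..x} f - f x * (y - x)) \<le> e * norm (y - x)"
        using \<open>d1 > 0\<close> \<open>d2 > 0\<close> by (intro exI[of _ "min d1 d2"]) auto
    qed (simp add: bounded_linear_mult_right)
  qed
qed

lemma abs_continuous_on_subinterval:
  assumes "abs_continuous_on a b f" "a \<le> c" "d \<le> b"
  shows "abs_continuous_on c d f"
  unfolding abs_continuous_on_def
proof (intro allI impI)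
  fix \<epsilon> :: real assume "\<epsilon> > 0"
  then obtain \<delta> where "\<delta> > 0" and \<delta>: "\<And>(n::nat) l r.
       (\<forall>i<n. a \<le> l i \<and> l i \<le> r i \<and> r i \<le> b) \<and>
       disjoint_family_on (\<lambda>i. {l i<..<r i}) {..<n} \<and>
       (\<Sum>i<n. r i - l i) < \<delta> \<Longrightarrow> (\<Sum>i<n. \<bar>f (r i) - f (l i)\<bar>) < \<epsilon>"
    using assms(1) unfolding abs_continuous_on_def by meson
  show "\<exists>\<delta>>0. \<forall>(n::nat) l r. (\<forall>i<n. c \<le> l i \<and> l i \<le> r i \<and> r i \<le> d) \<and>
       disjoint_family_on (\<lambda>i. {l i<..<r i}) {..<n} \<and> (\<Sum>i<n. r i - l i) < \<delta> \<longrightarrow>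
       (\<Sum>i<n. \<bar>f (r i) - f (l i)\<bar>) < \<epsilon>"
    using \<open>\<delta> > 0\<close> assms(2,3) by (intro exI[of _ \<delta>] conjI allI impI \<delta>) (auto intro: order_trans)
qed

lemma abs_continuous_on_const_add:
  assumes "abs_continuous_on a b f"
  shows "abs_continuous_on a b (\<lambda>t. c + f t)"
  using assms by (simp add: abs_continuous_on_def)

text \<open>Both factors are bounded by continuity, so an increment of the product is at most a constant times
  the sum of the increments of the factors.\<close>

lemma abs_continuous_on_mult:
  assumes f: "abs_continuous_on a b f" and g: "abs_continuous_on a b g"
  shows "abs_continuous_on a b (\<lambda>t. f t * g t)"
  unfolding abs_continuous_on_def
proof (intro allI impI)
  fix \<epsilon> :: real assume "\<epsilon> > 0"
  have "bounded (f ` {a..b})" "bounded (g ` {a..b})"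
    using f g by (auto intro!: compact_imp_bounded compact_continuous_image
        dest: abs_continuous_on_imp_continuous_on)
  then obtain B C where B: "B > 0" "\<And>t. t \<in> {a..b} \<Longrightarrow> \<bar>f t\<bar> \<le> B"
    and C: "C > 0" "\<And>t. t \<in> {a..b} \<Longrightarrow> \<bar>g t\<bar> \<le> C"
    unfolding bounded_pos by auto
  define M where "M = B + C"
  have M: "M > 0" "\<And>t. t \<in> {a..b} \<Longrightarrow> \<bar>f t\<bar> \<le> M" "\<And>t. t \<in> {a..b} \<Longrightarrow> \<bar>g t\<bar> \<le> M"
    using B(1) C(1) by (auto simp: M_def intro: order_trans[OF B(2)] order_trans[OF C(2)])
  define \<eta> where "\<eta> = \<epsilon> / (2 * M)"
  have "\<eta> > 0" using \<open>\<epsilon> > 0\<close> M(1) by (simp add: \<eta>_def)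
  obtain d1 where "d1 > 0" and d1: "\<And>(n::nat) l r.
       (\<forall>i<n. a \<le> l i \<and> l i \<le> r i \<and> r i \<le> b) \<and>
       disjoint_family_on (\<lambda>i. {l i<..<r i}) {..<n} \<and>
       (\<Sum>i<n. r i - l i) < d1 \<Longrightarrow> (\<Sum>i<n. \<bar>f (r i) - f (l i)\<bar>) < \<eta>"
    using f \<open>\<eta> > 0\<close> unfolding abs_continuous_on_def by meson
  obtain d2 where "d2 > 0" and d2: "\<And>(n::nat) l r.
       (\<forall>i<n. a \<le> l i \<and> l i \<le> r i \<and> r i \<le> b) \<and>
       disjoint_family_on (\<lambda>i. {l i<..<r i}) {..<n} \<and>
       (\<Sum>i<n. r i - l i) < d2 \<Longrightarrow> (\<Sum>i<n. \<bar>g (r i) - g (l i)\<bar>) < \<eta>"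
    using g \<open>\<eta> > 0\<close> unfolding abs_continuous_on_def by meson
  show "\<exists>\<delta>>0. \<forall>(n::nat) l r. (\<forall>i<n. a \<le> l i \<and> l i \<le> r i \<and> r i \<le> b) \<and>
       disjoint_family_on (\<lambda>i. {l i<..<r i}) {..<n} \<and> (\<Sum>i<n. r i - l i) < \<delta> \<longrightarrow>
       (\<Sum>i<n. \<bar>f (r i) * g (r i) - f (l i) * g (l i)\<bar>) < \<epsilon>"
  proof (intro exI[of _ "min d1 d2"] conjI allI impI)
    fix n :: nat and l r
    assume "(\<forall>i<n. a \<le> l i \<and> l i \<le> r i \<and> r i \<le> b) \<and>
       disjoint_family_on (\<lambda>i. {l i<..<r i}) {..<n} \<and> (\<Sum>i<n. r i - l i) < min d1 d2"
    then have lr: "\<forall>i<n. a \<le> l i \<and> l i \<le> r i \<and> r i \<le> b"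
      and disj: "disjoint_family_on (\<lambda>i. {l i<..<r i}) {..<n}"
      and len: "(\<Sum>i<n. r i - l i) < d1" "(\<Sum>i<n. r i - l i) < d2" by auto
    have "(\<Sum>i<n. \<bar>f (r i) * g (r i) - f (l i) * g (l i)\<bar>)
        \<le> (\<Sum>i<n. M * \<bar>f (r i) - f (l i)\<bar> + M * \<bar>g (r i) - g (l i)\<bar>)"
    proof (rule sum_mono)
      fix i assume "i \<in> {..<n}"
      then have in_ab: "l i \<in> {a..b}" "r i \<in> {a..b}" using lr by force+
      have "f (r i) * g (r i) - f (l i) * g (l i)
          = g (r i) * (f (r i) - f (l i)) + f (l i) * (g (r i) - g (l i))"
        by (simp add: algebra_simps)
      then have "\<bar>f (r i) * g (r i) - f (l i) * g (l i)\<bar>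
          \<le> \<bar>g (r i)\<bar> * \<bar>f (r i) - f (l i)\<bar> + \<bar>f (l i)\<bar> * \<bar>g (r i) - g (l i)\<bar>"
        by (metis abs_mult abs_triangle_ineq)
      also have "\<dots> \<le> M * \<bar>f (r i) - f (l i)\<bar> + M * \<bar>g (r i) - g (l i)\<bar>"
        using M in_ab by (intro add_mono mult_right_mono) auto
      finally show "\<bar>f (r i) * g (r i) - f (l i) * g (l i)\<bar>
          \<le> M * \<bar>f (r i) - f (l i)\<bar> + M * \<bar>g (r i) - g (l i)\<bar>" .
    qed
    also have "\<dots> = M * (\<Sum>i<n. \<bar>f (r i) - f (l i)\<bar>) + M * (\<Sum>i<n. \<bar>g (r i) - g (l i)\<bar>)"
      by (simp add: sum.distrib sum_distrib_left)
    also have "\<dots> < M * \<eta> + M * \<eta>"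
      using d1[of n l r] d2[of n l r] lr disj len M(1) by (intro add_strict_mono mult_strict_left_mono) auto
    also have "\<dots> = \<epsilon>" using M(1) by (simp add: \<eta>_def)
    finally show "(\<Sum>i<n. \<bar>f (r i) * g (r i) - f (l i) * g (l i)\<bar>) < \<epsilon>" .
  qed (use \<open>d1 > 0\<close> \<open>d2 > 0\<close> in auto)
qed

section \<open>Primitives of square-integrable functions\<close>

lemma AE_L01_iff_negligible:
  "(AE t in L01. P t) \<longleftrightarrow> (\<exists>N. negligible N \<and> (\<forall>t\<in>{0..1} - N. P t))"
proof -
  have "(AE t in L01. P t) \<longleftrightarrow> (\<exists>N. negligible N \<and> {t. \<not> (t \<in> {0..1} \<longrightarrow> P t)} \<subseteq> N)"
    by (simp add: AE_restrict_space_iff eventually_ae_filter_negligible)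
  moreover have "{t. \<not> (t \<in> {0..1} \<longrightarrow> P t)} \<subseteq> N \<longleftrightarrow> (\<forall>t\<in>{0..1} - N. P t)" for N
    by blast
  ultimately show ?thesis by simp
qed

lemma primitive_eq_integral:
  assumes "sq_integrable f" "t \<in> {0..1}"
  shows "(LINT s:{0..t}|lebesgue. f s) = integral {0..t} f"
  using set_lebesgue_integral_eq_integral(2)[OF sq_integrable_imp_set_integrable[OF assms]] .

lemma sq_integrable_set_integrable_subset:
  assumes "sq_integrable f" "E \<in> sets lebesgue" "E \<subseteq> {0..1}"
  shows "set_integrable lebesgue E f" "set_integrable lebesgue E (\<lambda>t. (f t)\<^sup>2)"
proof -
  have "set_integrable lebesgue {0..1} f" "set_integrable lebesgue {0..1} (\<lambda>t. (f t)\<^sup>2)"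
    using sq_integrable_imp_integrable[OF assms(1)] assms(1)
    by (auto simp: set_integrable_def integrable_restrict_space sq_integrable_def)
  then show "set_integrable lebesgue E f" "set_integrable lebesgue E (\<lambda>t. (f t)\<^sup>2)"
    using assms(2,3) by (auto intro: set_integrable_subset)
qed

lemma primitive_diff_le:
  assumes f: "sq_integrable f" and "0 \<le> l" "l \<le> r" "r \<le> 1"
  shows "\<bar>(LINT s:{0..r}|lebesgue. f s) - (LINT s:{0..l}|lebesgue. f s)\<bar>
      \<le> (LINT s:{l<..<r}|lebesgue. \<bar>f s\<bar>)"
proof -
  note int = sq_integrable_set_integrable_subset(1)[OF f]
  have "f integrable_on {0..r}"
    using assms by (intro set_lebesgue_integral_eq_integral(1) int) auto
  then have "integral {0..l} f + integral {l..r} f = integral {0..r} f"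
    using assms by (intro Henstock_Kurzweil_Integration.integral_combine) auto
  moreover have "integral {l..r} f = integral {l<..<r} f"
    by (rule integral_open_interval_real)
  moreover have "integral {l<..<r} f = (LINT s:{l<..<r}|lebesgue. f s)"
    using assms by (intro set_lebesgue_integral_eq_integral(2)[symmetric] int) auto
  ultimately have "(LINT s:{0..r}|lebesgue. f s) - (LINT s:{0..l}|lebesgue. f s)
      = (LINT s:{l<..<r}|lebesgue. f s)"
    using assms by (simp add: primitive_eq_integral)
  moreover have "norm (LINT s:{l<..<r}|lebesgue. f s) \<le> (LINT s:{l<..<r}|lebesgue. norm (f s))"
    using assms by (intro set_integral_norm_bound int) auto
  ultimately show ?thesis by simp
qed

text \<open>Square integrability gives a short proof. By Young's inequality
  \<open>\<bar>f\<bar> \<le> c f\<^sup>2 + 1 / (4 c)\<close>, so the integral of \<open>\<bar>f\<bar>\<close> over a set \<open>E\<close> is at most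
  \<open>c \<integral>f\<^sup>2 + measure E / (4 c)\<close>: a small \<open>c\<close> controls the first term, and then a small \<open>E\<close> the second.\<close>

lemma abs_continuous_on_primitive:
  assumes f: "sq_integrable f"
  shows "abs_continuous_on 0 1 (\<lambda>t. LINT s:{0..t}|lebesgue. f s)"
  unfolding abs_continuous_on_def
proof (intro allI impI)
  fix \<epsilon> :: real assume "\<epsilon> > 0"
  note int = sq_integrable_set_integrable_subset[OF f]
  define M where "M = (LINT s:{0..1}|lebesgue. (f s)\<^sup>2)"
  have "M \<ge> 0" unfolding M_def set_lebesgue_integral_def by (rule integral_nonneg_AE) auto
  define D where "D = M + 1"
  have "D > 0" using \<open>M \<ge> 0\<close> by (simp add: D_def)
  define c where "c = \<epsilon> / (2 * D)"
  have "c > 0" using \<open>\<epsilon> > 0\<close> \<open>D > 0\<close> by (simp add: c_def)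
  have "c * M \<le> c * D" using \<open>c > 0\<close> by (simp add: D_def)
  also have "\<dots> = \<epsilon> / 2" using \<open>D > 0\<close> by (simp add: c_def)
  finally have cM: "c * M \<le> \<epsilon> / 2" .
  have young: "\<bar>y\<bar> \<le> c * y\<^sup>2 + 1 / (4 * c)" for y :: real
  proof -
    have "0 \<le> (2 * c * \<bar>y\<bar> - 1)\<^sup>2 / (4 * c)" using \<open>c > 0\<close> by simp
    also have "\<dots> = c * y\<^sup>2 + 1 / (4 * c) - \<bar>y\<bar>"
      using \<open>c > 0\<close> by (simp add: power2_diff power_mult_distrib field_simps) (simp add: power2_eq_square)
    finally show ?thesis by simp
  qed
  show "\<exists>\<delta>>0. \<forall>(n::nat) l r. (\<forall>i<n. 0 \<le> l i \<and> l i \<le> r i \<and> r i \<le> 1) \<and>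
       disjoint_family_on (\<lambda>i. {l i<..<r i}) {..<n} \<and> (\<Sum>i<n. r i - l i) < \<delta> \<longrightarrow>
       (\<Sum>i<n. \<bar>(LINT s:{0..r i}|lebesgue. f s) - (LINT s:{0..l i}|lebesgue. f s)\<bar>) < \<epsilon>"
  \<comment> \<open>With this length, \<open>measure E / (4 c)\<close> stays below \<open>\<epsilon> / 2\<close>.\<close>
  proof (intro exI[of _ "2 * c * \<epsilon>"] conjI allI impI)
    show "0 < 2 * c * \<epsilon>" using \<open>c > 0\<close> \<open>\<epsilon> > 0\<close> by simp
    fix n :: nat and l r
    assume "(\<forall>i<n. 0 \<le> l i \<and> l i \<le> r i \<and> r i \<le> 1) \<and>
       disjoint_family_on (\<lambda>i. {l i<..<r i}) {..<n} \<and> (\<Sum>i<n. r i - l i) < 2 * c * \<epsilon>"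
    then have lr: "\<And>i. i < n \<Longrightarrow> 0 \<le> l i \<and> l i \<le> r i \<and> r i \<le> 1"
      and disj: "disjoint_family_on (\<lambda>i. {l i<..<r i}) {..<n}"
      and len: "(\<Sum>i<n. r i - l i) < 2 * c * \<epsilon>" by auto
    define E where "E = (\<Union>i<n. {l i<..<r i})"
    have E: "E \<in> sets lebesgue" "E \<subseteq> {0..1}" "E \<in> lmeasurable"
      unfolding E_def using lr by (auto intro!: fmeasurable.finite_UN) force+
    have "measure lebesgue E = (\<Sum>i<n. r i - l i)"
      unfolding E_def by (rule measure_disjoint_open_intervals) (use lr disj in auto)
    then have mE: "measure lebesgue E < 2 * c * \<epsilon>" using len by simp
    have intabs: "set_integrable lebesgue A (\<lambda>s. \<bar>f s\<bar>)" if "A \<in> sets lebesgue" "A \<subseteq> {0..1}" for A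
      using int(1)[OF that] by (rule set_integrable_abs)
    have intc: "set_integrable lebesgue E (\<lambda>s. 1 / (4 * c))"
    proof -
      have "integrable lebesgue (indicator E :: real \<Rightarrow> real)"
        using E(3) by (intro integrable_real_indicator) (auto simp: fmeasurable_def)
      then show ?thesis by (simp add: set_integrable_def)
    qed
    have "(\<Sum>i<n. \<bar>(LINT s:{0..r i}|lebesgue. f s) - (LINT s:{0..l i}|lebesgue. f s)\<bar>)
        \<le> (\<Sum>i<n. LINT s:{l i<..<r i}|lebesgue. \<bar>f s\<bar>)"
      by (rule sum_mono) (use lr f in \<open>auto intro!: primitive_diff_le\<close>)
    also have "\<dots> = (LINT s:E|lebesgue. \<bar>f s\<bar>)"
      unfolding E_def
    proof (rule set_integral_finite_Union[symmetric])
      show "set_integrable lebesgue {l i<..<r i} (\<lambda>s. \<bar>f s\<bar>)" if "i \<in> {..<n}" for i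
        by (rule intabs) (use lr[of i] that in auto)
    qed (use disj in auto)
    also have "\<dots> \<le> (LINT s:E|lebesgue. c * (f s)\<^sup>2 + 1 / (4 * c))"
      by (rule set_integral_mono)
        (use E int(2) intc young in \<open>auto intro!: intabs set_integral_add(1) set_integrable_mult_right\<close>)
    also have "\<dots> = (LINT s:E|lebesgue. c * (f s)\<^sup>2) + (LINT s:E|lebesgue. 1 / (4 * c))"
      by (rule set_integral_add(2)) (use E int(2) intc in \<open>auto intro!: set_integrable_mult_right\<close>)
    also have "(LINT s:E|lebesgue. c * (f s)\<^sup>2) = c * (LINT s:E|lebesgue. (f s)\<^sup>2)"
      by simp
    also have "(LINT s:E|lebesgue. 1 / (4 * c)) = measure lebesgue E / (4 * c)"
      using E(3) by (simp add: set_lebesgue_integral_def fmeasurable_def)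
    also have "(LINT s:E|lebesgue. (f s)\<^sup>2) \<le> M"
      unfolding M_def set_lebesgue_integral_def
      by (rule integral_mono)
        (use E int(2)[of E] int(2)[of "{0..1}"] in \<open>auto simp: set_integrable_def split: split_indicator\<close>)
    also have "c * M + measure lebesgue E / (4 * c) < \<epsilon> / 2 + 2 * c * \<epsilon> / (4 * c)"
      using cM mE \<open>c > 0\<close> by (intro add_le_less_mono divide_strict_right_mono) auto
    also have "\<dots> = \<epsilon>" using \<open>c > 0\<close> by simp
    finally show "(\<Sum>i<n. \<bar>(LINT s:{0..r i}|lebesgue. f s) - (LINT s:{0..l i}|lebesgue. f s)\<bar>) < \<epsilon>"
      using \<open>c > 0\<close> by simp
  qed
qed

lemma AE_has_derivative_primitive:
  assumes f: "sq_integrable f"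
  shows "AE t in L01. ((\<lambda>t. LINT s:{0..t}|lebesgue. f s) has_real_derivative f t) (at t within {0..1})"
proof -
  have "f absolutely_integrable_on {0..1}"
    by (rule sq_integrable_imp_set_integrable[OF f]) simp
  then obtain N where "negligible N" and N: "\<And>t. t \<in> {0..1} - N \<Longrightarrow>
      ((\<lambda>t. integral {0..t} f) has_real_derivative f t) (at t within {0..1})"
    by (rule indefinite_integral_has_derivative_off_negligible) blast
  have der: "((\<lambda>t. LINT s:{0..t}|lebesgue. f s) has_real_derivative f t) (at t within {0..1})"
    if "t \<in> {0..1} - N" for t
  proof (rule has_field_derivative_transform_within[OF N[OF that] zero_less_one])
    show "integral {0..s} f = (LINT s:{0..s}|lebesgue. f s)" if "s \<in> {0..1}" for s
      using primitive_eq_integral[OF f that] by (rule sym)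
  qed (use that in blast)
  show ?thesis
  proof (rule AE_L01_iff_negligible[THEN iffD2], intro exI conjI ballI)
    show "negligible N" by fact
  qed (rule der)
qed

text \<open>Hence every element of \<open>H_space\<close> is a constant plus an element of the range of the Volterra
  operator.\<close>

lemma abs_continuous_on_eq_primitive:
  assumes f: "abs_continuous_on 0 1 f" and g: "sq_integrable g"
    and der: "AE t in L01. (f has_real_derivative g t) (at t within {0..1})"
    and t: "t \<in> {0..1}"
  shows "f t = f 0 + (LINT s:{0..t}|lebesgue. g s)"
proof -
  obtain N where "negligible N" and N: "\<And>s. s \<in> {0..1} - N \<Longrightarrow>
      (f has_real_derivative g s) (at s within {0..1})"
    using der unfolding AE_L01_iff_negligible by auto
  have "(g has_integral f t - f 0) {0..t}"
  proof (rule abs_continuous_on_has_integral[OF _ _ \<open>negligible N\<close>])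
    show "abs_continuous_on 0 t f" using t by (intro abs_continuous_on_subinterval[OF f]) auto
    show "(f has_real_derivative g s) (at s within {0..t})" if "s \<in> {0..t} - N" for s
      by (rule has_field_derivative_subset[OF N]) (use that t in auto)
  qed (use t in auto)
  then have "integral {0..t} g = f t - f 0" by (rule integral_unique)
  then show ?thesis unfolding primitive_eq_integral[OF g t] by simp
qed

text \<open>The product of the two primitives is absolutely continuous with derivative \<open>F g + f G\<close> almost
  everywhere.\<close>

lemma primitive_integration_by_parts:
  assumes f: "sq_integrable f" and g: "sq_integrable g"
  defines "F \<equiv> \<lambda>t. LINT s:{0..t}|lebesgue. f s" and "G \<equiv> \<lambda>t. LINT s:{0..t}|lebesgue. g s"
  shows "(\<integral>t. F t * g t \<partial>L01) + (\<integral>t. f t * G t \<partial>L01) = F 1 * G 1"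
proof -
  have F: "sq_integrable F" "abs_continuous_on 0 1 F"
    and G: "sq_integrable G" "abs_continuous_on 0 1 G"
    unfolding F_def G_def using f g
    by (simp_all only: sq_integrable_volterra abs_continuous_on_primitive)
  have "F 0 = 0" using primitive_eq_integral[OF f, of 0] by (simp add: F_def)
  have "AE t in L01. ((\<lambda>t. F t * G t) has_real_derivative (F t * g t + f t * G t)) (at t within {0..1})"
    using AE_has_derivative_primitive[OF f] AE_has_derivative_primitive[OF g] unfolding F_def G_def
    by eventually_elim (rule DERIV_mult')
  then obtain N where "negligible N" and N: "\<And>t. t \<in> {0..1} - N \<Longrightarrow>
      ((\<lambda>t. F t * G t) has_real_derivative (F t * g t + f t * G t)) (at t within {0..1})"
    unfolding AE_L01_iff_negligible by auto
  have "((\<lambda>t. F t * g t + f t * G t) has_integral F 1 * G 1 - F 0 * G 0) {0..1}"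
    by (rule abs_continuous_on_has_integral[OF abs_continuous_on_mult[OF F(2) G(2)] _ \<open>negligible N\<close> N])
      auto
  then have "integral {0..1} (\<lambda>t. F t * g t + f t * G t) = F 1 * G 1"
    using \<open>F 0 = 0\<close> by (simp add: integral_unique)
  moreover have int: "integrable L01 (\<lambda>t. F t * g t)" "integrable L01 (\<lambda>t. f t * G t)"
    using F G f g by (auto intro: sq_integrable_mult)
  then have "integral {0..1} (\<lambda>t. F t * g t + f t * G t) = (\<integral>t. F t * g t + f t * G t \<partial>L01)"
    by (intro lebesgue_integral_eq_integral[symmetric]) auto
  ultimately show ?thesis using int by simp
qed

section \<open>Classes of functions and the Volterra operator\<close>

text \<open>The following lemmas let each class of functions be handled through one representative, and
  equalities between classes be checked on representatives.\<close>

lemma representative_exists: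
  obtains f where "representative x f" "sq_integrable f"
proof -
  have "\<exists>f. representative x f \<and> sq_integrable f"
    by transfer (auto simp: l2_eq_def)
  then show thesis using that by blast
qed

lemma representative_add:
  "representative x f \<Longrightarrow> representative y g \<Longrightarrow> representative (x + y) (\<lambda>t. f t + g t)"
proof (transfer, goal_cases)
  case (1 x f y g)
  then have "AE t in L01. x t = f t" "AE t in L01. y t = g t"
    by (auto simp: l2_eq_def)
  then have "AE t in L01. x t + y t = f t + g t" by eventually_elim simp
  with 1 show ?case by (auto simp: l2_eq_def intro: sq_integrable_add)
qed

lemma representative_volterra:
  assumes "representative x f"
  shows "representative (volterra x) (\<lambda>t. LINT s:{0..t}|lebesgue. f s)"
  using assms
proof (transfer, goal_cases)
  case (1 x f)
  then have "AE t in L01. (LINT s:{0..t}|lebesgue. x s) = (LINT s:{0..t}|lebesgue. f s)"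
    by (intro AE_I2) (auto intro: volterra_cong)
  moreover have "sq_integrable x" "sq_integrable f" using 1 by (auto simp: l2_eq_def)
  ultimately show ?case by (auto simp: l2_eq_def intro: sq_integrable_volterra)
qed

lemma representative_imp_sq_integrable: "representative x f \<Longrightarrow> sq_integrable f"
  by transfer (simp add: l2_eq_def)

lemma representative_eqI:
  assumes "representative x f" "representative y g" "AE t in L01. f t = g t"
  shows "x = y"
proof -
  have "l2_eq f g"
    using assms by (simp add: l2_eq_def representative_imp_sq_integrable)
  with assms(1,2) show ?thesis
  proof (transfer, goal_cases)
    case (1 x f y g)
    then show ?case using l2_eq_trans[OF l2_eq_trans] l2_eq_sym by blast
  qed
qed

lemma inner_representative:
  assumes "representative x f" "representative y g"
  shows "x \<bullet> y = (\<integral>t. f t * g t \<partial>L01)"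
  using assms
proof (transfer, goal_cases)
  case (1 x f y g)
  then have "AE t in L01. x t = f t" "AE t in L01. y t = g t"
    by (auto simp: l2_eq_def)
  then have "AE t in L01. x t * y t = f t * g t" by eventually_elim simp
  moreover have "(\<lambda>t. x t * y t) \<in> borel_measurable L01" "(\<lambda>t. f t * g t) \<in> borel_measurable L01"
    using 1 sq_integrable_mult[THEN borel_measurable_integrable] by (auto simp: l2_eq_def)
  ultimately show ?case by (intro integral_cong_AE)
qed

lift_definition one_l2 :: l2 is "\<lambda>_. 1"
  by (simp add: l2_eq_def sq_integrable_def finite_measure.integrable_const[OF finite_measure_L01])

lemma representative_const: "representative (c *\<^sub>R one_l2) (\<lambda>_. c)"
  by transfer (simp add: l2_eq_def sq_integrable_def finite_measure.integrable_const[OF finite_measure_L01])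

lemma inner_one_representative:
  assumes "representative x f" "sq_integrable f"
  shows "x \<bullet> one_l2 = (LINT s:{0..1}|lebesgue. f s)"
  using inner_representative[OF assms(1) representative_const[of 1]]
  by (simp add: set_lebesgue_integral_def integral_restrict_space)

lemma inner_one_one: "one_l2 \<bullet> one_l2 = 1"
  using inner_representative[OF representative_const[of 1] representative_const[of 1]]
  by (simp add: measure_restrict_space)

lemma volterra_add: "volterra (x + y) = volterra x + volterra y"
proof -
  obtain f where f: "representative x f" "sq_integrable f" by (rule representative_exists)
  obtain g where g: "representative y g" "sq_integrable g" by (rule representative_exists)
  show ?thesis
  proof (rule representative_eqI)
    show "representative (volterra (x + y)) (\<lambda>t. LINT s:{0..t}|lebesgue. f s + g s)"
      using f g by (intro representative_add representative_volterra)
    show "representative (volterra x + volterra y)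
        (\<lambda>t. (LINT s:{0..t}|lebesgue. f s) + (LINT s:{0..t}|lebesgue. g s))"
      using f g by (intro representative_add representative_volterra)
    show "AE t in L01. (LINT s:{0..t}|lebesgue. f s + g s)
        = (LINT s:{0..t}|lebesgue. f s) + (LINT s:{0..t}|lebesgue. g s)"
      by (intro AE_I2 set_integral_add(2) sq_integrable_imp_set_integrable f(2) g(2)) simp_all
  qed
qed

lemma volterra_scaleR: "volterra (c *\<^sub>R x) = c *\<^sub>R volterra x"
proof transfer
  fix c and f :: "real \<Rightarrow> real" assume "l2_eq f f"
  then have "sq_integrable f" by (simp add: l2_eq_def)
  then show "l2_eq (\<lambda>t. LINT s:{0..t}|lebesgue. c * f s) (\<lambda>t. c * (LINT s:{0..t}|lebesgue. f s))"
    by (simp add: l2_eq_def sq_integrable_scale sq_integrable_volterra)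
qed

lemma ac_representative_const_add_volterra:
  assumes "representative y g" "sq_integrable g"
  shows "ac_representative (d *\<^sub>R one_l2 + volterra y) (\<lambda>t. d + (LINT s:{0..t}|lebesgue. g s))"
  unfolding ac_representative_def
  using assms by (intro conjI representative_add representative_const representative_volterra
      abs_continuous_on_const_add abs_continuous_on_primitive)

text \<open>The Volterra operator is injective and its range contains no nonzero constant. A primitive that is
  almost everywhere equal to \<open>c\<close> is equal to \<open>c\<close> everywhere by continuity; its value at 0 gives
  \<open>c = 0\<close>, and its derivative gives that the integrand vanishes almost everywhere.\<close>

lemma volterra_eq_const:
  assumes "volterra u = c *\<^sub>R one_l2"
  shows "u = 0" "c = 0"
proof -
  obtain f where f: "representative u f" "sq_integrable f" by (rule representative_exists)
  let ?F = "\<lambda>t. LINT s:{0..t}|lebesgue. f s"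
  have F: "?F t = c" if "t \<in> {0..1}" for t
    using ac_representative_unique[OF _ _ that, of "volterra u" "\<lambda>t. 0 + ?F t" "\<lambda>_. c"]
      ac_representative_const_add_volterra[OF f, of 0] representative_const[of c] assms
    by (simp add: ac_representative_def abs_continuous_on_def)
  have "AE t in L01. f t = 0"
  proof -
    obtain N where N: "negligible N"
      "\<And>t. t \<in> {0..1} - N \<Longrightarrow> (?F has_real_derivative f t) (at t within {0..1})"
      using AE_has_derivative_primitive[OF f(2)] unfolding AE_L01_iff_negligible by auto
    have "f t = 0" if t: "t \<in> {0..1} - N" for t
    proof -
      have "((\<lambda>_. c) has_real_derivative f t) (at t within {0..1})"
        by (rule has_field_derivative_transform_within[OF N(2)[OF t] zero_less_one])
          (use t F in auto)
      then have "((\<lambda>_. c) has_vector_derivative f t) (at t within {0..1})"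
        by (simp add: has_real_derivative_iff_has_vector_derivative)
      then show ?thesis
        using vector_derivative_unique_within_closed_interval[of 0 1 t "\<lambda>_. c" "f t" 0] t by simp
    qed
    then show ?thesis using N(1) unfolding AE_L01_iff_negligible by blast
  qed
  then show "u = 0" using representative_eqI[OF f(1) representative_const[of 0]] by simp
  have "?F 0 = 0" using primitive_eq_integral[OF f(2), of 0] by simp
  then show "c = 0" using F[of 0] by simp
qed

text \<open>Integration by parts says that \<open>volterra\<close> plus its adjoint is the rank one projection onto the
  constants. The formula for the adjoint and the quadratic form of both operators are read off from it.\<close>

lemma volterra_inner_by_parts:
  "volterra u \<bullet> w + u \<bullet> volterra w = (u \<bullet> one_l2) * (w \<bullet> one_l2)"
proof -
  obtain f where f: "representative u f" "sq_integrable f" by (rule representative_exists)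
  obtain g where g: "representative w g" "sq_integrable g" by (rule representative_exists)
  show ?thesis
    using primitive_integration_by_parts[OF f(2) g(2)]
    by (simp only: inner_one_representative[OF f] inner_one_representative[OF g]
      inner_representative[OF representative_volterra[OF f(1)] g(1)]
      inner_representative[OF f(1) representative_volterra[OF g(1)]])
qed

lemma H_space_eq: "H_space = {d *\<^sub>R one_l2 + volterra y |d y. True}"
proof (intro set_eqI iffI)
  fix x assume "x \<in> H_space"
  then obtain f g where f: "ac_representative x f" and g: "sq_integrable g"
    and der: "AE t in L01. (f has_real_derivative g t) (at t within {0..1})"
    unfolding H_space_def by blast
  have y: "representative (abs_l2 g) g"
    using g by (simp add: representative.abs_eq l2_eq_refl)
  have "x = f 0 *\<^sub>R one_l2 + volterra (abs_l2 g)"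
  proof (rule representative_eqI)
    show "representative x f" using f by (simp add: ac_representative_def)
    show "representative (f 0 *\<^sub>R one_l2 + volterra (abs_l2 g))
        (\<lambda>t. f 0 + (LINT s:{0..t}|lebesgue. g s))"
      by (intro representative_add representative_const representative_volterra y)
    show "AE t in L01. f t = f 0 + (LINT s:{0..t}|lebesgue. g s)"
      by (rule AE_I2, rule abs_continuous_on_eq_primitive[OF _ g der])
        (use f in \<open>auto simp: ac_representative_def\<close>)
  qed
  then show "x \<in> {d *\<^sub>R one_l2 + volterra y |d y. True}" by blast
next
  fix x assume "x \<in> {d *\<^sub>R one_l2 + volterra y |d y. True}"
  then obtain d y where x: "x = d *\<^sub>R one_l2 + volterra y" by blast
  obtain g where g: "representative y g" "sq_integrable g" by (rule representative_exists)
  have "AE t in L01. ((\<lambda>t. d + (LINT s:{0..t}|lebesgue. g s)) has_real_derivative g t) (at t within {0..1})"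
    using AE_has_derivative_primitive[OF g(2)]
    by eventually_elim (auto intro!: derivative_eq_intros)
  then show "x \<in> H_space"
    unfolding H_space_def x using ac_representative_const_add_volterra[OF g] g(2) by blast
qed

lemma point_value_eq:
  assumes "ac_representative x f" "t \<in> {0..1}"
  shows "point_value x t = f t"
  unfolding point_value_def
  by (rule ac_representative_unique[OF someI[of "ac_representative x", OF assms(1)] assms])

lemma point_values_const_add_volterra:
  "point_value (d *\<^sub>R one_l2 + volterra y) 0 = d"
  "point_value (d *\<^sub>R one_l2 + volterra y) 1 = d + y \<bullet> one_l2"
proof -
  obtain g where g: "representative y g" "sq_integrable g" by (rule representative_exists)
  note pv = point_value_eq[OF ac_representative_const_add_volterra[OF g]]
  show "point_value (d *\<^sub>R one_l2 + volterra y) 0 = d"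
    using pv[of 0 d] primitive_eq_integral[OF g(2), of 0] by simp
  show "point_value (d *\<^sub>R one_l2 + volterra y) 1 = d + y \<bullet> one_l2"
    using pv[of 1 d] inner_one_representative[OF g] by simp
qed

section \<open>The graphs of the three operators\<close>

text \<open>The adjoint of the Volterra operator, that is, integration from \<open>t\<close> to 1, written as the
  integral over the whole interval minus the integral from 0 to \<open>t\<close>.\<close>

definition volterra_adj :: "l2 \<Rightarrow> l2" where
  "volterra_adj w = (w \<bullet> one_l2) *\<^sub>R one_l2 - volterra w"

lemma inner_volterra: "volterra u \<bullet> w = u \<bullet> volterra_adj w"
  using volterra_inner_by_parts[of u w]
  by (simp add: volterra_adj_def inner_diff_right algebra_simps)

lemma inner_volterra_self: "volterra u \<bullet> u = (u \<bullet> one_l2)\<^sup>2 / 2"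
  using volterra_inner_by_parts[of u u] by (simp add: inner_commute power2_eq_square)

lemma volterra_minus: "volterra (- x) = - volterra x"
  using volterra_scaleR[of "-1" x] by simp

lemma volterra_zero: "volterra 0 = 0"
  using volterra_scaleR[of 0 0] by simp

lemma gra_T_op: "gra T_op = range (\<lambda>u. (volterra u, u))"
  by (auto simp: gra_def T_op_def op_inverse_def)

lemma gra_T_adjoint: "gra (op_adjoint T_op) = range (\<lambda>w. (volterra_adj w, w))"
proof -
  have "(x, x') \<in> gra (op_adjoint T_op) \<longleftrightarrow> x = volterra_adj x'" for x x'
  proof -
    have "(x, x') \<in> gra (op_adjoint T_op) \<longleftrightarrow> (\<forall>u. u \<bullet> (volterra_adj x' - x) = 0)"
      unfolding gra_def op_adjoint_def orthogonal_comp_def gra_T_op[unfolded gra_def]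
      by (simp add: orthogonal_def inner_volterra inner_diff_right)
    also have "\<dots> \<longleftrightarrow> x = volterra_adj x'"
      using inner_eq_zero_iff[of "volterra_adj x' - x"] by (metis eq_iff_diff_eq_0 inner_zero_right)
    finally show ?thesis .
  qed
  then show ?thesis by auto
qed

section \<open>Fitzpatrick functions\<close>

text \<open>Used for suprema over subspaces: a linear functional with a nonzero value takes all real values.\<close>

lemma SUP_ereal_eq_PInfty_if_scalable:
  fixes g :: "'a \<Rightarrow> real"
  assumes "p \<noteq> 0" "\<And>s::real. \<exists>u\<in>A. g u = s * p"
  shows "(SUP u\<in>A. ereal (g u)) = \<infinity>"
proof (rule SUP_PInfty)
  fix n :: nat
  obtain u where "u \<in> A" "g u = (real n / p) * p" using assms(2) by blast
  then show "\<exists>u\<in>A. ereal (real n) \<le> ereal (g u)"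
    using assms(1) by (intro bexI[of _ u]) auto
qed

text \<open>Both Fitzpatrick functions are suprema of this kind, since both operators have the quadratic form
  \<open>(u \<bullet> one_l2)\<^sup>2 / 2\<close>. That form vanishes on the functions with mean 0, so the supremum is infinite as
  soon as \<open>z\<close> has a component orthogonal to the constants. For \<open>z\<close> a constant \<open>c\<close> only the mean \<open>s\<close> of
  \<open>u\<close> matters, and \<open>c s - s\<^sup>2 / 2\<close> is largest at \<open>s = c\<close>.\<close>

lemma SUP_linear_minus_square:
  "(SUP u. ereal (z \<bullet> u - (u \<bullet> one_l2)\<^sup>2 / 2)) =
    (if z = (z \<bullet> one_l2) *\<^sub>R one_l2 then ereal ((z \<bullet> one_l2)\<^sup>2 / 2) else \<infinity>)"
proof (cases "z = (z \<bullet> one_l2) *\<^sub>R one_l2")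
  case True
  define c where "c = z \<bullet> one_l2"
  have eq: "z \<bullet> u - (u \<bullet> one_l2)\<^sup>2 / 2 = c\<^sup>2 / 2 - (c - u \<bullet> one_l2)\<^sup>2 / 2" for u
  proof -
    have "z \<bullet> u = c * (u \<bullet> one_l2)"
      using True by (metis c_def inner_commute inner_scaleR_left)
    then show ?thesis by (simp add: power2_diff field_simps)
  qed
  have "(SUP u. ereal (z \<bullet> u - (u \<bullet> one_l2)\<^sup>2 / 2)) = ereal (c\<^sup>2 / 2)"
  proof (rule antisym)
    show "(SUP u. ereal (z \<bullet> u - (u \<bullet> one_l2)\<^sup>2 / 2)) \<le> ereal (c\<^sup>2 / 2)"
      by (rule SUP_least) (simp add: eq)
    show "ereal (c\<^sup>2 / 2) \<le> (SUP u. ereal (z \<bullet> u - (u \<bullet> one_l2)\<^sup>2 / 2))"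
      by (rule SUP_upper2[of "c *\<^sub>R one_l2"]) (simp_all only: eq UNIV_I, simp add: inner_one_one)
  qed
  with True show ?thesis by (simp add: c_def)
next
  case False
  define p where "p = z - (z \<bullet> one_l2) *\<^sub>R one_l2"
  have "p \<noteq> 0" using False by (simp add: p_def)
  have p1: "p \<bullet> one_l2 = 0" by (simp add: p_def inner_diff_left inner_one_one)
  have "z = p + (z \<bullet> one_l2) *\<^sub>R one_l2" by (simp add: p_def)
  then have "z \<bullet> p = p \<bullet> p"
    using p1 by (metis inner_add_left inner_scaleR_left inner_commute mult_zero_right add.right_neutral)
  then have "(SUP u. ereal (z \<bullet> u - (u \<bullet> one_l2)\<^sup>2 / 2)) = \<infinity>"
    using \<open>p \<noteq> 0\<close> p1
    by (intro SUP_ereal_eq_PInfty_if_scalable[of "p \<bullet> p"]) (auto intro!: exI[of _ "s *\<^sub>R p" for s])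
  with False show ?thesis by simp
qed

lemma fitzpatrick_T:
  "fitzpatrick T_op (x, x') = (SUP u. ereal ((x + volterra_adj x') \<bullet> u - (u \<bullet> one_l2)\<^sup>2 / 2))"
proof -
  have "x \<bullet> u + volterra u \<bullet> x' - volterra u \<bullet> u
      = (x + volterra_adj x') \<bullet> u - (u \<bullet> one_l2)\<^sup>2 / 2" for u
    unfolding inner_volterra_self by (simp add: inner_volterra inner_add_left inner_commute[of u "volterra_adj x'"])
  then show ?thesis
    by (simp add: fitzpatrick_def gra_T_op image_comp comp_def)
qed

lemma fitzpatrick_T_adjoint:
  "fitzpatrick (op_adjoint T_op) (x, x') = (SUP w. ereal ((x + volterra x') \<bullet> w - (w \<bullet> one_l2)\<^sup>2 / 2))"
proof -
  have "x \<bullet> w + volterra_adj w \<bullet> x' - volterra_adj w \<bullet> w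
      = (x + volterra x') \<bullet> w - (w \<bullet> one_l2)\<^sup>2 / 2" for w
  proof -
    have "volterra_adj w \<bullet> v = volterra v \<bullet> w" for v
      by (metis inner_volterra inner_commute)
    then show ?thesis using inner_volterra_self[of w] by (simp add: inner_add_left)
  qed
  then show ?thesis
    by (simp add: fitzpatrick_def gra_T_adjoint image_comp comp_def)
qed

text \<open>If \<open>volterra u = volterra_adj w\<close>, then \<open>volterra (u + w)\<close> is constant, so \<open>w = - u\<close> by injectivity
  and the values \<open>u + w\<close> of the sum are all 0. The domain consists of the primitives that vanish at
  both ends.\<close>

lemma gra_sum_T_adjoint:
  "gra (op_sum T_op (op_adjoint T_op)) = (\<lambda>u. (volterra u, 0)) ` {u. u \<bullet> one_l2 = 0}"
proof -
  have T: "u \<in> T_op a \<longleftrightarrow> a = volterra u" for a u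
    using gra_T_op by (auto simp: gra_def)
  have T': "w \<in> op_adjoint T_op a \<longleftrightarrow> a = volterra_adj w" for a w
    using gra_T_adjoint by (auto simp: gra_def)
  have key: "volterra u = volterra_adj w \<longleftrightarrow> w = - u \<and> u \<bullet> one_l2 = 0" for u w
  proof
    assume "volterra u = volterra_adj w"
    then have "volterra (u + w) = (w \<bullet> one_l2) *\<^sub>R one_l2"
      by (simp add: volterra_add volterra_adj_def)
    from volterra_eq_const[OF this] show "w = - u \<and> u \<bullet> one_l2 = 0"
      by (metis add_eq_0_iff inner_minus_left neg_equal_0_iff_equal)
  qed (simp add: volterra_adj_def volterra_minus)
  show ?thesis
    unfolding gra_def op_sum_def T T' 
    by (auto simp: key image_iff)
qed

text \<open>As the sum is zero on a subspace, its Fitzpatrick function is the support function of that subspace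
  in the second argument. The claim therefore says that the domain is dense, which is shown by
  testing a nonzero \<open>x'\<close> against one suitable element of the domain.\<close>

lemma fitzpatrick_sum_T_adjoint:
  "fitzpatrick (op_sum T_op (op_adjoint T_op)) (x, x') = indicator_fun (UNIV \<times> {0}) (x, x')"
proof -
  let ?D = "{u. u \<bullet> one_l2 = 0}"
  have F: "fitzpatrick (op_sum T_op (op_adjoint T_op)) (x, x') = (SUP u\<in>?D. ereal (volterra u \<bullet> x'))"
    by (simp add: fitzpatrick_def gra_sum_T_adjoint image_comp comp_def)
  show ?thesis
  proof (cases "x' = 0")
    case True
    have "(0::l2) \<in> ?D" by simp
    then have "?D \<noteq> {}" by blast
    then show ?thesis using True unfolding F by (simp add: indicator_fun_def)
  next
    case False
    define z where "z = volterra_adj x'"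
    \<comment> \<open>The mean 0 part of \<open>z\<close>: it is nonzero because otherwise \<open>volterra x'\<close> would be a constant.\<close>
    define p where "p = z - (z \<bullet> one_l2) *\<^sub>R one_l2"
    have "p \<bullet> one_l2 = 0" by (simp add: p_def inner_diff_left inner_one_one)
    have "p \<noteq> 0"
    proof
      assume "p = 0"
      then have "volterra x' = (x' \<bullet> one_l2 - z \<bullet> one_l2) *\<^sub>R one_l2"
        by (simp add: p_def z_def volterra_adj_def scaleR_left_diff_distrib algebra_simps)
      then show False using volterra_eq_const(1) False by blast
    qed
    have "z = p + (z \<bullet> one_l2) *\<^sub>R one_l2" by (simp add: p_def)
    then have "volterra p \<bullet> x' = p \<bullet> p"
      using \<open>p \<bullet> one_l2 = 0\<close> unfolding inner_volterra z_def[symmetric]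
      by (metis inner_add_right inner_scaleR_right mult_zero_right add.right_neutral)
    then have "(SUP u\<in>?D. ereal (volterra u \<bullet> x')) = \<infinity>"
      using \<open>p \<noteq> 0\<close> \<open>p \<bullet> one_l2 = 0\<close>
      by (intro SUP_ereal_eq_PInfty_if_scalable[of "p \<bullet> p"])
        (auto simp: volterra_scaleR intro!: exI[of _ "s *\<^sub>R p" for s])
    then show ?thesis using False unfolding F by (simp add: indicator_fun_def)
  qed
qed

text \<open>The two terms are finite only if \<open>x + volterra_adj (x' - y)\<close> is a constant \<open>c\<close> and
  \<open>x + volterra y\<close> is a constant \<open>d\<close>. Subtracting shows that \<open>volterra x'\<close> is a constant, hence
  \<open>x' = 0\<close>. The second condition then says that \<open>x\<close> is the absolutely continuous function with initial
  value \<open>d\<close> and derivative \<open>- y\<close>, and the first one holds with \<open>c\<close> the final value of \<open>x\<close>. So \<open>c\<close> and \<open>d\<close>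
  are the two boundary values of \<open>x\<close>, and the finite value does not depend on \<open>y\<close>.\<close>

lemma fitzpatrick_T_plus_fitzpatrick_T_adjoint:
  "fitzpatrick T_op (x, x' - y) + fitzpatrick (op_adjoint T_op) (x, y) =
    (if x' = 0 \<and> (\<exists>d. x = d *\<^sub>R one_l2 + volterra (- y))
     then ereal (1 / 2 * ((point_value x 1)\<^sup>2 + (point_value x 0)\<^sup>2)) else \<infinity>)"
proof -
  have span: "z = (z \<bullet> one_l2) *\<^sub>R one_l2 \<longleftrightarrow> (\<exists>c. z = c *\<^sub>R one_l2)" for z
    by (auto simp: inner_one_one)
  have scalar: "(c *\<^sub>R one_l2) \<bullet> one_l2 = c" for c by (simp add: inner_one_one)
  let ?a = "x + volterra_adj (x' - y)" and ?b = "x + volterra y"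
  have "(\<exists>c d. ?a = c *\<^sub>R one_l2 \<and> ?b = d *\<^sub>R one_l2)
      \<longleftrightarrow> x' = 0 \<and> (\<exists>d. x = d *\<^sub>R one_l2 + volterra (- y))"
  proof (intro iffI conjI; elim exE conjE)
    fix c d assume a: "?a = c *\<^sub>R one_l2" and b: "?b = d *\<^sub>R one_l2"
    have "volterra x' = (d - c + (x' - y) \<bullet> one_l2) *\<^sub>R one_l2"
    proof -
      have "volterra (x' - y) + volterra y = volterra x'"
        by (simp flip: volterra_add)
      moreover have "volterra (x' - y) = x + ((x' - y) \<bullet> one_l2) *\<^sub>R one_l2 - c *\<^sub>R one_l2"
        using a by (simp add: volterra_adj_def algebra_simps)
      moreover have "volterra y = d *\<^sub>R one_l2 - x" using b by (simp add: algebra_simps)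
      ultimately show ?thesis by (simp add: algebra_simps)
    qed
    then show "x' = 0" by (rule volterra_eq_const(1))
    show "\<exists>d. x = d *\<^sub>R one_l2 + volterra (- y)"
      using b by (auto simp: volterra_minus algebra_simps intro!: exI[of _ d])
  next
    fix d assume "x' = 0" and x: "x = d *\<^sub>R one_l2 + volterra (- y)"
    then show "\<exists>c d. ?a = c *\<^sub>R one_l2 \<and> ?b = d *\<^sub>R one_l2"
      by (intro exI[of _ "d - y \<bullet> one_l2"] exI[of _ d])
        (simp add: volterra_adj_def volterra_minus algebra_simps)
  qed
  moreover have "ereal ((?a \<bullet> one_l2)\<^sup>2 / 2) + ereal ((?b \<bullet> one_l2)\<^sup>2 / 2)
      = ereal (1 / 2 * ((point_value x 1)\<^sup>2 + (point_value x 0)\<^sup>2))"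
    if "x' = 0" "x = d *\<^sub>R one_l2 + volterra (- y)" for d
  proof -
    have "?a = (d - y \<bullet> one_l2) *\<^sub>R one_l2" "?b = d *\<^sub>R one_l2"
      using that by (simp_all add: volterra_adj_def volterra_minus algebra_simps)
    then have "?a \<bullet> one_l2 = d - y \<bullet> one_l2" "?b \<bullet> one_l2 = d"
      by (simp_all only: scalar)
    moreover have "point_value x 1 = d - y \<bullet> one_l2" "point_value x 0 = d"
      using point_values_const_add_volterra[of d "- y"] that(2) by simp_all
    ultimately show ?thesis by (simp only: plus_ereal.simps) (simp add: add_divide_distrib)
  qed
  ultimately show ?thesis
    unfolding fitzpatrick_T fitzpatrick_T_adjoint SUP_linear_minus_square span
    by auto
qed

theorem theorem4p16:
  shows "(\<forall>x x'. fitzpatrick (op_sum T_op (op_adjoint T_op)) (x, x') =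
                  indicator_fun (UNIV \<times> {0}) (x, x')) \<and>
         (\<forall>x x'. (fitzpatrick T_op \<box>\<^sub>2 fitzpatrick (op_adjoint T_op)) (x, x') =
           (if (x, x') \<in> H_space \<times> {0}
            then ereal (1 / 2 * ((point_value x 1)\<^sup>2 + (point_value x 0)\<^sup>2))
            else \<infinity>)) \<and>
         fitzpatrick T_op \<box>\<^sub>2 fitzpatrick (op_adjoint T_op) \<noteq>
           fitzpatrick (op_sum T_op (op_adjoint T_op))"
proof -
  let ?F = "fitzpatrick T_op \<box>\<^sub>2 fitzpatrick (op_adjoint T_op)"
  let ?v = "\<lambda>x. ereal (1 / 2 * ((point_value x 1)\<^sup>2 + (point_value x 0)\<^sup>2))"
  have conv: "?F (x, x') = (if (x, x') \<in> H_space \<times> {0} then ?v x else \<infinity>)" for x x'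
  proof (cases "(x, x') \<in> H_space \<times> {0}")
    case True
    then obtain d y where "x' = 0" and x: "x = d *\<^sub>R one_l2 + volterra (- (- y))"
      unfolding H_space_eq by auto
    have "?F (x, x') = ?v x"
      unfolding partial_inf_conv_def prod.case fitzpatrick_T_plus_fitzpatrick_T_adjoint
    proof (rule antisym)
      show "(INF y. if x' = 0 \<and> (\<exists>d. x = d *\<^sub>R one_l2 + volterra (- y)) then ?v x else \<infinity>) \<le> ?v x"
        by (rule INF_lower2[of "- y"]) (use \<open>x' = 0\<close> x in auto)
    qed (rule INF_greatest, simp)
    with True show ?thesis by simp
  next
    case False
    then have "\<not> (x' = 0 \<and> (\<exists>d. x = d *\<^sub>R one_l2 + volterra (- y)))" for y
      unfolding H_space_eq by auto
    then have "?F (x, x') = \<infinity>"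
      unfolding partial_inf_conv_def prod.case fitzpatrick_T_plus_fitzpatrick_T_adjoint by (simp only: if_False) simp
    with False show ?thesis by simp
  qed
  \<comment> \<open>The constant function 1 separates the two functions: its boundary values give
      \<open>(1 + 1) / 2 = 1\<close>, not 0.\<close>
  have one: "one_l2 = 1 *\<^sub>R one_l2 + volterra 0" by (simp add: volterra_zero)
  have "one_l2 \<in> H_space" unfolding H_space_eq using one by blast
  moreover have "point_value one_l2 0 = 1" "point_value one_l2 1 = 1"
    using point_values_const_add_volterra[of 1 0] one by simp_all
  ultimately have "?F (one_l2, 0) = 1" by (simp add: conv one_ereal_def)
  moreover have "fitzpatrick (op_sum T_op (op_adjoint T_op)) (one_l2, 0) = 0"
    by (simp add: fitzpatrick_sum_T_adjoint indicator_fun_def)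
  ultimately have "?F \<noteq> fitzpatrick (op_sum T_op (op_adjoint T_op))"
    by (metis zero_neq_one)
  then show ?thesis using fitzpatrick_sum_T_adjoint conv by blast
qed

end
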